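(* A morphism $f:X\to Y$ in $\mathcal{C}/\mathcal{T}$ is a monomorphism in $\mathcal{C}/\mathcal{T}$ if and only if the induced map $$\mathrm{Hom}_{\mathcal{C}/\mathcal{T}}(\tau^{-1}S,f):\mathrm{Hom}_{\mathcal{C}/\mathcal{T}}(\tau^{-1}S,X)\to \mathrm{Hom}_{\mathcal{C}/\mathcal{T}}(\tau^{-1}S,Y)$$ is a monomorphism for all $S\in\mathcal{T}$.
   Context: Fix a field $K$. All categories are $K$-linear Krull–Schmidt categories: every object is a finite formal direct sum of indecomposable objects with local endomorphism rings. The category $\mathcal{B}$ has indecomposable objects the pairs $(x,y)\in\mathbb{R}^2$, with $\mathrm{Hom}_{\mathcal{B}}((x,y),(x',y'))=K$ if $x\le x'$ and $y\le y'$, and $0$ otherwise; composition is multiplication of scalars; the morphism corresponding to $1\in K$ is the basic morphism. Let $\mathcal{B}_\pi$ be the full additive subcategory generated by all $(x,y)$ with $|y-x|\ge\pi$. The continuous derived category $\mathcal{D}$ is the full additive subcategory of $\mathcal{B}/\mathcal{B}_\pi$ (quotient by the ideal of morphisms factoring through objects of $\mathcal{B}_\pi$) generated by the $(x,y)$ with $|y-x|<\pi$. The doubled category $\mathcal{D}^{(2)}$ is obtained by adding a second copy $(x,y)'$ of every indecomposable $(x,y)$ together with an isomorphism $\eta:(x,y)'\cong(x,y)$; put $(x,y)''=(x,y)$. Let $F$ be the automorphism of $\mathcal{D}^{(2)}$ given on objects by $F(x,y)=(y+\pi,x+\pi)'$, taking basic morphisms to basic morphisms. The continuous cluster category $\mathcal{C}=\mathcal{C}_\pi$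 is the orbit category $\mathcal{D}^{(2)}/F$, with $\mathrm{Hom}_{\mathcal{C}}(X,Y)=\bigoplus_{k\in\mathbb{Z}}\mathrm{Hom}_{\mathcal{D}^{(2)}}(X,F^kY)$. The orbit of $(x,y)$ is denoted $M(x,y)$ (and that of $(x,y)'$ is $M(x,y)'\cong M(x,y)$), so $M(x,y)=M(y+\pi,x+\pi)'$. The standard cluster $\mathcal{T}$ is the set of objects $M\left(\frac{m\pi}{2^n},\pi+\frac{(m-1)\pi}{2^n}\right)$ for integers $n\ge0$, $0\le m<2^{n+1}$ (omitting $(\pi,\pi)$, which repeats $(0,0)$). $\mathcal{C}/\mathcal{T}$ is the quotient of $\mathcal{C}$ by the ideal of morphisms which factor through an object of $\mathrm{add}\,\mathcal{T}$ (finite direct sums of objects of $\mathcal{T}$, up to isomorphism). For $S=M(x,y)\in\mathcal{T}$ and small $\epsilon>0$ let $S_\epsilon=M(x+\epsilon,y+\epsilon)$. For an object $X$, $\mathrm{Hom}_{\mathcal{C}/\mathcal{T}}(\tau^{-1}S,X):=\lim_{\epsilon\to0+}\mathrm{Hom}_{\mathcal{C}/\mathcal{T}}(S_\epsilon,X)$ (the direct limit along composition with the basic morphisms $S_\epsilon\to S_\delta$, $\epsilon<\delta$); this is a covariant functor of $X\in\mathcal{C}/\mathcal{T}$. *)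

theory Defs
  imports Complex_Main "HOL-Algebra.Coset" "HOL-Algebra.FiniteProduct"
    "HOL-Algebra.Product_Groups" "Jordan_Normal_Form.Matrix"
begin

section \<open>Categories enriched in abelian groups\<close>

text \<open>
  The hom-groups are abelian groups in the sense of HOL-Algebra, written multiplicatively: the
  monoid operation is the addition of morphisms and the monoid unit is the zero morphism.
  The composite of \<open>f : X \<rightarrow> Y\<close> and \<open>g : Y \<rightarrow> Z\<close> is \<open>Cmp \<C> X Y Z g f\<close>.
  In the categories below the scalar action of the ground field is composition with the scalar
  multiples of identities, so it is not recorded as a separate component.
\<close>

record ('o, 'm) precat =
  Obj :: "'o set"
  Hom :: "'o \<Rightarrow> 'o \<Rightarrow> 'm monoid"
  Cmp :: "'o \<Rightarrow> 'o \<Rightarrow> 'o \<Rightarrow> 'm \<Rightarrow> 'm \<Rightarrow> 'm"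
  Idn :: "'o \<Rightarrow> 'm"

definition is_mono :: "('o, 'm) precat \<Rightarrow> 'o \<Rightarrow> 'o \<Rightarrow> 'm \<Rightarrow> bool" where
  "is_mono \<C> X Y f \<longleftrightarrow>
     f \<in> carrier (Hom \<C> X Y) \<and>
     (\<forall>W \<in> Obj \<C>. \<forall>g \<in> carrier (Hom \<C> W X). \<forall>h \<in> carrier (Hom \<C> W X).
        Cmp \<C> W X Y f g = Cmp \<C> W X Y f h \<longrightarrow> g = h)"

definition isomorphic :: "('o, 'm) precat \<Rightarrow> 'o \<Rightarrow> 'o \<Rightarrow> bool" where
  "isomorphic \<C> X Y \<longleftrightarrow>
     (\<exists>f \<in> carrier (Hom \<C> X Y). \<exists>g \<in> carrier (Hom \<C> Y X).
        Cmp \<C> X Y X g f = Idn \<C> X \<and> Cmp \<C> Y X Y f g = Idn \<C> Y)"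

definition full_subcat :: "('o, 'm) precat \<Rightarrow> 'o set \<Rightarrow> ('o, 'm) precat" where
  "full_subcat \<C> S = \<C>\<lparr>Obj := Obj \<C> \<inter> S\<rparr>"

definition thru :: "('o, 'm) precat \<Rightarrow> 'o set \<Rightarrow> 'o \<Rightarrow> 'o \<Rightarrow> 'm set" where
  "thru \<C> S X Y =
     {f \<in> carrier (Hom \<C> X Y).
        \<exists>Z \<in> S. \<exists>g \<in> carrier (Hom \<C> X Z). \<exists>h \<in> carrier (Hom \<C> Z Y). f = Cmp \<C> X Z Y h g}"

text \<open>
  When \<open>S\<close> contains a zero object and is closed under direct sums, \<open>thru \<C> S X Y\<close> is a subgroup of
  the group of morphisms; this is the case in all uses below. The morphisms of the quotient
  category are its cosets.
\<close>

definition quot_mor :: "('o, 'm) precat \<Rightarrow> 'o set \<Rightarrow> 'o \<Rightarrow> 'o \<Rightarrow> 'm \<Rightarrow> 'm set" where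
  "quot_mor \<C> S X Y f = thru \<C> S X Y #>\<^bsub>Hom \<C> X Y\<^esub> f"

definition quot_cat :: "('o, 'm) precat \<Rightarrow> 'o set \<Rightarrow> ('o, 'm set) precat" where
  "quot_cat \<C> S =
     \<lparr>Obj = Obj \<C>,
      Hom = (\<lambda>X Y. Hom \<C> X Y Mod thru \<C> S X Y),
      Cmp = (\<lambda>X Y Z G F. \<Union>g\<in>G. \<Union>f\<in>F. quot_mor \<C> S X Z (Cmp \<C> X Y Z g f)),
      Idn = (\<lambda>X. quot_mor \<C> S X X (Idn \<C> X))\<rparr>"

text \<open>
  Objects of the additive categories below are formal direct sums of indecomposables, encoded as
  lists. Doubling tags every summand with a Boolean, \<open>True\<close> marking the second copy \<open>p'\<close> of \<open>p\<close>.
  A morphism between tagged objects is a morphism between the underlying ones, so that the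
  isomorphism \<open>\<eta> : p' \<rightarrow> p\<close> is given by the identity of \<open>p\<close>.
\<close>

definition doubled :: "('a list, 'm) precat \<Rightarrow> (('a \<times> bool) list, 'm) precat" where
  "doubled \<C> =
     \<lparr>Obj = {X. map fst X \<in> Obj \<C>},
      Hom = (\<lambda>X Y. Hom \<C> (map fst X) (map fst Y)),
      Cmp = (\<lambda>X Y Z. Cmp \<C> (map fst X) (map fst Y) (map fst Z)),
      Idn = (\<lambda>X. Idn \<C> (map fst X))\<rparr>"

text \<open>
  Orbit category of an automorphism with powers \<open>FO k\<close> on objects and \<open>FM k\<close> on morphisms. An
  object stands for its orbit: the identity of \<open>X\<close>, placed in the appropriate degree, is an
  isomorphism from \<open>X\<close> to \<open>FO k X\<close>. A morphism \<open>X \<rightarrow> Y\<close> is a finitely supported family of morphisms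
  \<open>X \<rightarrow> FO k Y\<close>; the degree \<open>n\<close> component of \<open>\<psi> \<circ> \<phi>\<close> is the sum over \<open>k\<close> of
  \<open>FM k (\<psi> (n - k)) \<circ> \<phi> k\<close>.
\<close>

definition orbit_mor :: "('o, 'm) precat \<Rightarrow> (int \<Rightarrow> 'o \<Rightarrow> 'o) \<Rightarrow> 'o \<Rightarrow> 'o \<Rightarrow> 'm \<Rightarrow> int \<Rightarrow> 'm" where
  "orbit_mor \<C> FO X Y f = (\<lambda>k. if k = 0 then f else \<one>\<^bsub>Hom \<C> X (FO k Y)\<^esub>)"

definition orbit_cat ::
    "('o, 'm) precat \<Rightarrow> (int \<Rightarrow> 'o \<Rightarrow> 'o) \<Rightarrow> (int \<Rightarrow> 'o \<Rightarrow> 'o \<Rightarrow> 'm \<Rightarrow> 'm) \<Rightarrow> ('o, int \<Rightarrow> 'm) precat" where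
  "orbit_cat \<C> FO FM =
     \<lparr>Obj = Obj \<C>,
      Hom = (\<lambda>X Y. sum_group UNIV (\<lambda>k. Hom \<C> X (FO k Y))),
      Cmp = (\<lambda>X Y Z \<psi> \<phi> n.
         finprod (Hom \<C> X (FO n Z))
           (\<lambda>k. Cmp \<C> X (FO k Y) (FO n Z) (FM k Y (FO (n - k) Z) (\<psi> (n - k))) (\<phi> k))
           {k. \<phi> k \<noteq> \<one>\<^bsub>Hom \<C> X (FO k Y)\<^esub>}),
      Idn = (\<lambda>X. orbit_mor \<C> FO X X (Idn \<C> X))\<rparr>"


section \<open>The continuous cluster category\<close>

type_synonym pt = "real \<times> real"
type_synonym pt2 = "pt \<times> bool"

text \<open>
  A morphism \<open>X \<rightarrow> Y\<close> of the category of formal direct sums is a matrix whose \<open>(i, j)\<close> entry is the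
  coefficient of the basic morphism from the \<open>j\<close>-th summand of \<open>X\<close> to the \<open>i\<close>-th summand of \<open>Y\<close>.
\<close>

definition pt_le :: "pt \<Rightarrow> pt \<Rightarrow> bool" where
  "pt_le p q \<longleftrightarrow> fst p \<le> fst q \<and> snd p \<le> snd q"

definition cat_B :: "(pt list, 'k::field mat) precat" where
  "cat_B =
     \<lparr>Obj = UNIV,
      Hom = (\<lambda>X Y.
         \<lparr>carrier = {A \<in> carrier_mat (length Y) (length X).
            \<forall>i < length Y. \<forall>j < length X. \<not> pt_le (X ! j) (Y ! i) \<longrightarrow> A $$ (i, j) = 0},
          monoid.mult = (+),
          one = 0\<^sub>m (length Y) (length X)\<rparr>),
      Cmp = (\<lambda>X Y Z g f. g * f),
      Idn = (\<lambda>X. 1\<^sub>m (length X))\<rparr>"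

definition B_pi :: "pt list set" where
  "B_pi = {X. \<forall>p \<in> set X. \<bar>snd p - fst p\<bar> \<ge> pi}"

definition cat_D :: "(pt list, 'k::field mat set) precat" where
  "cat_D = full_subcat (quot_cat cat_B B_pi) {X. \<forall>p \<in> set X. \<bar>snd p - fst p\<bar> < pi}"

definition cat_D2 :: "(pt2 list, 'k::field mat set) precat" where
  "cat_D2 = doubled cat_D"

definition F_ind :: "pt2 \<Rightarrow> pt2" where
  "F_ind = (\<lambda>((x, y), b). ((y + pi, x + pi), \<not> b))"

definition F_ob :: "int \<Rightarrow> pt2 list \<Rightarrow> pt2 list" where
  "F_ob k = map (if 0 \<le> k then F_ind ^^ nat k else inv_into UNIV F_ind ^^ nat (- k))"

text \<open>
  Every power of \<open>F\<close> is linear and takes basic morphisms to basic morphisms (those between different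
  copies included, so \<open>\<eta>\<close> goes to the inverse of \<open>\<eta>\<close>), hence it does not change the matrix of
  coefficients that represents a morphism.
\<close>

definition F_mor :: "int \<Rightarrow> pt2 list \<Rightarrow> pt2 list \<Rightarrow> 'k::field mat set \<Rightarrow> 'k mat set" where
  "F_mor k X Y c =
     (\<Union>A\<in>c. quot_mor cat_B B_pi (map fst (F_ob k X)) (map fst (F_ob k Y)) A)"

definition cat_C :: "(pt2 list, int \<Rightarrow> 'k::field mat set) precat" where
  "cat_C = orbit_cat cat_D2 F_ob F_mor"

definition M :: "pt \<Rightarrow> pt2 list" where
  "M p = [(p, False)]"


section \<open>The standard cluster and the quotient by it\<close>

text \<open>The objects of the standard cluster are the \<open>M p\<close> with \<open>p\<close> in the following set.\<close>

definition std_cluster :: "pt set" where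
  "std_cluster =
     {(of_int m * pi / 2 ^ n, pi + (of_int m - 1) * pi / 2 ^ n) | (m::int) (n::nat).
        0 \<le> m \<and> m < 2 ^ (n + 1)} - {(pi, pi)}"

definition add_T :: "'k::field itself \<Rightarrow> pt2 list set" where
  "add_T _ =
     {Z \<in> Obj (cat_C :: (pt2 list, int \<Rightarrow> 'k mat set) precat).
        \<exists>ps. set ps \<subseteq> std_cluster \<and>
          isomorphic (cat_C :: (pt2 list, int \<Rightarrow> 'k mat set) precat) Z (concat (map M ps))}"

type_synonym 'k ct_mor = "(int \<Rightarrow> 'k mat set) set"

definition cat_CT :: "(pt2 list, 'k::field ct_mor) precat" where
  "cat_CT = quot_cat cat_C (add_T TYPE('k))"


section \<open>The functors on the quotient defined by direct limits\<close>

definition S_eps :: "pt \<Rightarrow> real \<Rightarrow> pt2 list" where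
  "S_eps p e = M (fst p + e, snd p + e)"

text \<open>The class of the basic morphism from \<open>S_eps p e\<close> to \<open>S_eps p d\<close>, for \<open>e \<le> d\<close>.\<close>

definition S_basic :: "pt \<Rightarrow> real \<Rightarrow> real \<Rightarrow> 'k::field ct_mor" where
  "S_basic p e d =
     quot_mor cat_C (add_T TYPE('k)) (S_eps p e) (S_eps p d)
       (orbit_mor cat_D2 F_ob (S_eps p e) (S_eps p d)
         (quot_mor cat_B B_pi (map fst (S_eps p e)) (map fst (S_eps p d)) (1\<^sub>m 1)))"

text \<open>
  The direct limit is the set of pairs \<open>(e, g)\<close> with \<open>e > 0\<close> and \<open>g : S_eps p e \<rightarrow> X\<close>, where two pairs
  are identified if their restrictions to some smaller parameter agree. All \<open>S_eps p e\<close> with \<open>e > 0\<close>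
  are objects of the category, and restricting to small \<open>e\<close> does not change the limit.
\<close>

definition germs :: "pt \<Rightarrow> pt2 list \<Rightarrow> (real \<times> 'k::field ct_mor) set" where
  "germs p X = (SIGMA e:{0<..}. carrier (Hom cat_CT (S_eps p e) X))"

definition germ_rel :: "pt \<Rightarrow> pt2 list \<Rightarrow> (real \<times> 'k::field ct_mor) rel" where
  "germ_rel p X =
     {((e, g), (d, h)). (e, g) \<in> germs p X \<and> (d, h) \<in> germs p X \<and>
        (\<exists>c. 0 < c \<and> c \<le> e \<and> c \<le> d \<and>
           Cmp cat_CT (S_eps p c) (S_eps p e) X g (S_basic p c e) =
           Cmp cat_CT (S_eps p c) (S_eps p d) X h (S_basic p c d))}"

definition tau_Hom :: "pt \<Rightarrow> pt2 list \<Rightarrow> (real \<times> 'k::field ct_mor) set set" where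
  "tau_Hom p X = germs p X // germ_rel p X"

definition tau_Hom_map ::
    "pt \<Rightarrow> pt2 list \<Rightarrow> pt2 list \<Rightarrow> 'k::field ct_mor \<Rightarrow>
      (real \<times> 'k ct_mor) set \<Rightarrow> (real \<times> 'k ct_mor) set" where
  "tau_Hom_map p X Y f u =
     (\<Union>(e, g)\<in>u. germ_rel p Y `` {(e, Cmp cat_CT (S_eps p e) X Y f g)})"

end

theory Submission
  imports Defs
begin

text \<open>
  Let \<open>f : X \<rightarrow> Y\<close> be a morphism of \<open>C/T\<close>. If \<open>f\<close> is a monomorphism and two germs become equal after
  composition with \<open>f\<close>, then they become equal on one \<open>S\<^sub>c\<close>, where \<open>f\<close> can be cancelled. For the
  converse it is enough that germs separate morphisms: if \<open>g \<noteq> h : W \<rightarrow> X\<close>, there are \<open>S\<close> in the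
  standard cluster and \<open>u : S\<^sub>c \<rightarrow> W\<close> such that \<open>g u\<close> and \<open>h u\<close> stay different after restriction to
  every smaller \<open>S\<^sub>d\<close> (lemma \<open>separating_germ\<close>). Then \<open>f g = f h\<close> with \<open>g \<noteq> h\<close> contradicts
  injectivity on the germs at \<open>S\<close>.

  Separation is a statement about one pair of indecomposables. Say that \<open>g\<close> and \<open>h\<close> differ in the
  coefficient of a basic morphism \<open>w \<rightarrow> v\<close>, where \<open>w = (x, y)\<close> and \<open>v = (x', y')\<close> in the plane. That
  this basic morphism is nonzero in \<open>C/T\<close> means \<open>x \<le> x' < y + \<pi>\<close>, \<open>y \<le> y' < x + \<pi>\<close>, and that the box
  spanned by \<open>w\<close> and \<open>v\<close> contains no lift of an object of the cluster. View a point \<open>(t, s)\<close> as the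
  chord of a circle with end points \<open>t\<close> and \<open>s + \<pi>\<close> modulo \<open>2\<pi>\<close>. The cluster is the dyadic
  triangulation of the disk, and the condition says that \<open>[x, x']\<close> and \<open>[y + \<pi>, y' + \<pi>]\<close> are disjoint
  arcs that no chord of the triangulation connects. Then some chord \<open>(t, s)\<close> separates the two arcs,
  with its end points in the interiors of the two gaps (lemma \<open>separating_edge\<close>): among the levels
  of dyadic subdivision that put a vertex into both gaps take the coarsest one. In the gap that is
  empty one level earlier there is a single new vertex, and its two neighbours are joined by a
  chord, so they cannot both lie on the arcs. Since chords of a triangulation do not cross, no chord
  starts in \<open>(t, x']\<close> and ends in \<open>(s + \<pi>, y' + \<pi>]\<close>. So the basic morphism from \<open>(t + d, s + d)\<close> to \<open>v\<close>
  is nonzero in \<open>C/T\<close> for all small \<open>d > 0\<close>, and it factors through \<open>w\<close>.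

  To work with coefficients, every category in the construction of \<open>C/T\<close> is shown to have the same
  shape (locale \<open>based_cat\<close>): a morphism between lists of indecomposables is a finitely supported
  family of scalars indexed by a degree, a target summand and a source summand, and composition is
  convolution, truncated to those places where a basic morphism exists. This shape is inherited by
  the quotient by a set of indecomposables, where the basic morphisms that factor through the set
  disappear (lemma \<open>based_cat_quot\<close>), and by the orbit category (lemma \<open>based_cat_orbit\<close>). The passages
  from \<open>B\<close> to \<open>D\<close> and from \<open>C\<close> to \<open>C/T\<close> are two instances of the first lemma.
\<close>

section \<open>Categories with a multiplicative basis\<close>

text \<open>
  A triple consists of a degree, the index of a target summand and the index of a source summand.
\<close>

type_synonym 'k coeffs = "int \<times> nat \<times> nat \<Rightarrow> 'k"

text \<open>
  \<open>R n a b\<close> says that there is a basic morphism of degree \<open>n\<close> from \<open>a\<close> to \<open>b\<close>; there is at most one for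
  each \<open>n\<close>.
\<close>

definition pos :: "(int \<Rightarrow> 'a \<Rightarrow> 'a \<Rightarrow> bool) \<Rightarrow> 'a list \<Rightarrow> 'a list \<Rightarrow> (int \<times> nat \<times> nat) set" where
  "pos R X Y = {(n, i, j). i < length Y \<and> j < length X \<and> R n (X ! j) (Y ! i)}"

definition supp :: "'k::zero coeffs \<Rightarrow> (int \<times> nat \<times> nat) set" where
  "supp e = {t. e t \<noteq> 0}"

definition truncate :: "(int \<times> nat \<times> nat) set \<Rightarrow> 'k::zero coeffs \<Rightarrow> 'k coeffs" where
  "truncate P e = (\<lambda>t. if t \<in> P then e t else 0)"

text \<open>
  This is matrix multiplication in the summand indices combined with multiplication of Laurent
  polynomials in the degree. It is the composition law before the products of basic morphisms that
  vanish are discarded.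
\<close>

definition conv :: "'k::comm_ring_1 coeffs \<Rightarrow> 'k coeffs \<Rightarrow> 'k coeffs" where
  "conv g f = (\<lambda>(n, i, j). \<Sum>(k, l) \<in> {(k, l). f (k, l, j) \<noteq> 0}. g (n - k, i, l) * f (k, l, j))"

lemma pos_iff: "(n, i, j) \<in> pos R X Y \<longleftrightarrow> i < length Y \<and> j < length X \<and> R n (X ! j) (Y ! i)"
  by (simp add: pos_def)

lemma finite_column:
  assumes "finite (supp f)"
  shows "finite {(k, l). f (k, l, j) \<noteq> 0}"
proof -
  have "{(k, l). f (k, l, j) \<noteq> 0} \<subseteq> (\<lambda>(k, l, j). (k, l)) ` supp f"
    by (force simp: supp_def)
  then show ?thesis
    using assms by (meson finite_imageI finite_subset)
qed

lemma conv_eq_sum: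
  fixes f g :: "'k::comm_ring_1 coeffs"
  assumes "finite A" "\<And>k l. f (k, l, j) \<noteq> 0 \<Longrightarrow> g (n - k, i, l) \<noteq> 0 \<Longrightarrow> (k, l) \<in> A" "finite (supp f)"
  shows "conv g f (n, i, j) = (\<Sum>(k, l) \<in> A. g (n - k, i, l) * f (k, l, j))"
proof -
  have zero: "g (n - k, i, l) = 0" if "f (k, l, j) \<noteq> 0" "(k, l) \<notin> A" for k l
    using assms(2) that by blast
  show ?thesis
    unfolding conv_def prod.case
    by (rule sum.mono_neutral_cong) (use assms(1) finite_column[OF assms(3), of j] zero in auto)
qed

lemma conv_nonzeroD:
  assumes "conv g f (n, i, j) \<noteq> 0"
  obtains k l where "f (k, l, j) \<noteq> 0" "g (n - k, i, l) \<noteq> 0"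
proof -
  obtain t where "t \<in> {(k, l). f (k, l, j) \<noteq> 0}" "(case t of (k, l) \<Rightarrow> g (n - k, i, l) * f (k, l, j)) \<noteq> 0"
    using assms unfolding conv_def prod.case by (meson sum.neutral)
  then show thesis
    by (cases t) (auto intro: that)
qed

lemma supp_truncate: "supp (truncate P e) = supp e \<inter> P"
  by (auto simp: supp_def truncate_def)

lemma finite_supp_conv:
  assumes "finite (supp f)" "finite (supp g)"
  shows "finite (supp (conv g f))"
proof -
  have "supp (conv g f) \<subseteq> (\<lambda>((m, i, _), (k, _, j)). (m + k, i, j)) ` (supp g \<times> supp f)"
  proof
    fix t assume t: "t \<in> supp (conv g f)"
    obtain n i j where [simp]: "t = (n, i, j)" by (cases t)
    from t obtain k l where "f (k, l, j) \<noteq> 0" "g (n - k, i, l) \<noteq> 0"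
      by (auto simp: supp_def elim: conv_nonzeroD)
    then show "t \<in> (\<lambda>((m, i, _), (k, _, j)). (m + k, i, j)) ` (supp g \<times> supp f)"
      by (intro image_eqI[of _ _ "((n - k, i, l), (k, l, j))"]) (auto simp: supp_def)
  qed
  then show ?thesis
    using assms by (meson finite_SigmaI finite_imageI finite_subset)
qed

lemma conv_assoc:
  fixes e f g :: "'k::comm_ring_1 coeffs"
  assumes fe: "finite (supp e)" and ff: "finite (supp f)" and fg: "finite (supp g)"
  shows "conv (conv g f) e = conv g (conv f e)"
proof
  fix t :: "int \<times> nat \<times> nat"
  obtain n i j where [simp]: "t = (n, i, j)" by (cases t)
  define E where "E = {(k, l). e (k, l, j) \<noteq> 0}"
  define A where "A = (\<lambda>(k, l, _). (k, l)) ` supp f"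
  define B where "B = (\<lambda>((k, l), (k', l')). (k + k', l)) ` (A \<times> E)"
  have fin: "finite E" "finite A" "finite B"
    using fe ff finite_column[OF fe] by (auto simp: E_def A_def B_def)
  have "conv (conv g f) e t = (\<Sum>(k', l') \<in> E. conv g f (n - k', i, l') * e (k', l', j))"
    using fin fe by (auto simp: E_def intro!: conv_eq_sum)
  also have "\<dots> = (\<Sum>(k', l') \<in> E. \<Sum>(k, l) \<in> B. g (n - k, i, l) * f (k - k', l, l') * e (k', l', j))"
  proof (intro sum.cong refl, clarsimp)
    fix k' l' assume kl: "(k', l') \<in> E"
    let ?A = "(\<lambda>(k, l). (k - k', l)) ` B"
    have "conv g f (n - k', i, l') = (\<Sum>(k, l) \<in> ?A. g (n - k' - k, i, l) * f (k, l, l'))"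
    proof (intro conv_eq_sum ff)
      fix k l assume "f (k, l, l') \<noteq> 0"
      then have "(k, l) \<in> A" by (force simp: A_def supp_def)
      with kl have "(k + k', l) \<in> B" by (force simp: B_def)
      then show "(k, l) \<in> ?A" by (force)
    qed (use fin in auto)
    also have "\<dots> = (\<Sum>(k, l) \<in> B. g (n - k, i, l) * f (k - k', l, l'))"
      by (subst sum.reindex) (auto simp: inj_on_def case_prod_unfold)
    finally show "conv g f (n - k', i, l') * e (k', l', j) =
        (\<Sum>(k, l) \<in> B. g (n - k, i, l) * f (k - k', l, l') * e (k', l', j))"
      by (simp add: sum_distrib_right case_prod_unfold)
  qed
  also have "\<dots> = (\<Sum>(k, l) \<in> B. \<Sum>(k', l') \<in> E. g (n - k, i, l) * f (k - k', l, l') * e (k', l', j))"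
    unfolding case_prod_unfold by (rule sum.swap)
  also have "\<dots> = (\<Sum>(k, l) \<in> B. g (n - k, i, l) * conv f e (k, l, j))"
    by (rule sum.cong) (auto simp: conv_def E_def sum_distrib_left case_prod_unfold mult.assoc)
  also have "\<dots> = conv g (conv f e) t"
  proof (simp, rule conv_eq_sum[symmetric])
    fix k l assume "conv f e (k, l, j) \<noteq> 0"
    then obtain k' l' where "e (k', l', j) \<noteq> 0" "f (k - k', l, l') \<noteq> 0"
      by (rule conv_nonzeroD)
    then have "(k', l') \<in> E" "(k - k', l) \<in> A"
      by (auto simp: E_def A_def supp_def intro!: image_eqI[of _ _ "(k - k', l, l')"])
    then show "(k, l) \<in> B"
      by (auto simp: B_def intro!: image_eqI[of _ _ "((k - k', l), (k', l'))"])
  qed (use fin fe ff finite_supp_conv in auto)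
  finally show "conv (conv g f) e t = conv g (conv f e) t" .
qed

text \<open>
  Only products of two nonzero coefficients matter. This is how a change of the factors outside the
  relevant places is shown to leave a convolution unchanged.
\<close>

lemma conv_cong:
  assumes "\<And>k l. f (k, l, j) \<noteq> 0 \<or> f' (k, l, j) \<noteq> 0 \<Longrightarrow> g (n - k, i, l) \<noteq> 0 \<or> g' (n - k, i, l) \<noteq> 0 \<Longrightarrow>
      f (k, l, j) = f' (k, l, j) \<and> g (n - k, i, l) = g' (n - k, i, l)"
    and "finite (supp f)" "finite (supp f')"
  shows "conv g f (n, i, j) = conv g' f' (n, i, j)"
proof -
  let ?A = "{(k, l). f (k, l, j) \<noteq> 0} \<union> {(k, l). f' (k, l, j) \<noteq> 0}"
  have A: "finite ?A"
    using assms finite_column by blast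
  have "conv g f (n, i, j) = (\<Sum>(k, l) \<in> ?A. g (n - k, i, l) * f (k, l, j))"
    by (rule conv_eq_sum[OF A]) (use assms in auto)
  also have "\<dots> = (\<Sum>(k, l) \<in> ?A. g' (n - k, i, l) * f' (k, l, j))"
    by (rule sum.cong, simp, clarsimp) (metis assms(1) mult_zero_left mult_zero_right)
  also have "\<dots> = conv g' f' (n, i, j)"
    by (rule conv_eq_sum[OF A, symmetric]) (use assms in auto)
  finally show ?thesis .
qed

text \<open>
  \<open>R (k + l) a c\<close> decides whether the composite of the basic morphisms \<open>a \<rightarrow> b\<close> and \<open>b \<rightarrow> c\<close> of degrees
  \<open>k\<close> and \<open>l\<close> is the basic morphism of degree \<open>k + l\<close> or zero. Coherence says that a threefold composite
  can only be nonzero if both partial composites are; this makes the truncated composition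
  associative.
\<close>

locale basis_rel =
  fixes R :: "int \<Rightarrow> 'a \<Rightarrow> 'a \<Rightarrow> bool"
  assumes coherent: "R k a b \<Longrightarrow> R l b c \<Longrightarrow> R m c d \<Longrightarrow> R (k + l + m) a d \<Longrightarrow>
      R (k + l) a c \<and> R (l + m) b d"
    and R_id: "R k a b \<Longrightarrow> R 0 a a \<and> R 0 b b"

text \<open>
  The coefficient maps \<open>co\<close> identify the morphisms from \<open>X\<close> to \<open>Y\<close> with all finitely supported
  families on the places \<open>pos R X Y\<close>. The identity of a summand \<open>a\<close> is zero unless \<open>R 0 a a\<close>, which is how
  the summands that a quotient kills are recognized. The conditions range over all lists, whether they
  are objects or not, so passing to a full subcategory does not affect them.
\<close>

locale based_cat = basis_rel R
  for R :: "int \<Rightarrow> 'a \<Rightarrow> 'a \<Rightarrow> bool" +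
  fixes C :: "('a list, 'm) precat" and co :: "'a list \<Rightarrow> 'a list \<Rightarrow> 'm \<Rightarrow> 'k::field coeffs"
  assumes one_closed: "\<one>\<^bsub>Hom C X Y\<^esub> \<in> carrier (Hom C X Y)"
    and mult_closed: "f \<in> carrier (Hom C X Y) \<Longrightarrow> g \<in> carrier (Hom C X Y) \<Longrightarrow>
      f \<otimes>\<^bsub>Hom C X Y\<^esub> g \<in> carrier (Hom C X Y)"
    and co_bij: "bij_betw (co X Y) (carrier (Hom C X Y)) {e. finite (supp e) \<and> supp e \<subseteq> pos R X Y}"
    and co_mult: "f \<in> carrier (Hom C X Y) \<Longrightarrow> g \<in> carrier (Hom C X Y) \<Longrightarrow>
      co X Y (f \<otimes>\<^bsub>Hom C X Y\<^esub> g) = (\<lambda>t. co X Y f t + co X Y g t)"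
    and co_one: "co X Y \<one>\<^bsub>Hom C X Y\<^esub> = (\<lambda>_. 0)"
    and Cmp_closed: "f \<in> carrier (Hom C X Y) \<Longrightarrow> g \<in> carrier (Hom C Y Z) \<Longrightarrow>
      Cmp C X Y Z g f \<in> carrier (Hom C X Z)"
    and co_Cmp: "f \<in> carrier (Hom C X Y) \<Longrightarrow> g \<in> carrier (Hom C Y Z) \<Longrightarrow>
      co X Z (Cmp C X Y Z g f) = truncate (pos R X Z) (conv (co Y Z g) (co X Y f))"
    and Idn_closed: "Idn C X \<in> carrier (Hom C X X)"
    and co_Idn: "co X X (Idn C X) = truncate (pos R X X) (\<lambda>(n, i, j). if n = 0 \<and> i = j then 1 else 0)"
begin

lemma finite_supp_co: "f \<in> carrier (Hom C X Y) \<Longrightarrow> finite (supp (co X Y f))"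
  and supp_co_subset: "f \<in> carrier (Hom C X Y) \<Longrightarrow> supp (co X Y f) \<subseteq> pos R X Y"
  using co_bij[of X Y] by (auto dest: bij_betwE)

lemma co_nonzeroD: "f \<in> carrier (Hom C X Y) \<Longrightarrow> co X Y f (n, i, j) \<noteq> 0 \<Longrightarrow> (n, i, j) \<in> pos R X Y"
  using supp_co_subset[of f X Y] by (auto simp: supp_def)

lemma co_eqD: "co X Y f = co X Y g \<Longrightarrow> f \<in> carrier (Hom C X Y) \<Longrightarrow> g \<in> carrier (Hom C X Y) \<Longrightarrow> f = g"
  using co_bij[of X Y] by (auto simp: bij_betw_def inj_on_def)

lemma ex_co:
  assumes "finite (supp e)" "supp e \<subseteq> pos R X Y"
  obtains f where "f \<in> carrier (Hom C X Y)" "co X Y f = e"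
proof -
  have "e \<in> co X Y ` carrier (Hom C X Y)"
    using co_bij[of X Y] assms by (simp add: bij_betw_def)
  then show thesis using that by blast
qed

lemma comm_group_Hom: "comm_group (Hom C X Y)"
proof (rule comm_groupI)
  fix f assume f: "f \<in> carrier (Hom C X Y)"
  have "supp (\<lambda>t. - co X Y f t) = supp (co X Y f)"
    by (simp add: supp_def)
  then obtain g where g: "g \<in> carrier (Hom C X Y)" "co X Y g = (\<lambda>t. - co X Y f t)"
    using ex_co[of "\<lambda>t. - co X Y f t" X Y] finite_supp_co[OF f] supp_co_subset[OF f] by metis
  then have "g \<otimes>\<^bsub>Hom C X Y\<^esub> f = \<one>\<^bsub>Hom C X Y\<^esub>"
    using f by (intro co_eqD[of X Y]) (auto simp: co_mult co_one mult_closed one_closed)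
  then show "\<exists>g\<in>carrier (Hom C X Y). g \<otimes>\<^bsub>Hom C X Y\<^esub> f = \<one>\<^bsub>Hom C X Y\<^esub>"
    using g by blast
next
  fix f g assume "f \<in> carrier (Hom C X Y)" "g \<in> carrier (Hom C X Y)"
  then show "f \<otimes>\<^bsub>Hom C X Y\<^esub> g = g \<otimes>\<^bsub>Hom C X Y\<^esub> f"
    by (intro co_eqD[of X Y]) (auto simp: co_mult mult_closed add.commute)
next
  fix f g h assume "f \<in> carrier (Hom C X Y)" "g \<in> carrier (Hom C X Y)" "h \<in> carrier (Hom C X Y)"
  then show "f \<otimes>\<^bsub>Hom C X Y\<^esub> g \<otimes>\<^bsub>Hom C X Y\<^esub> h = f \<otimes>\<^bsub>Hom C X Y\<^esub> (g \<otimes>\<^bsub>Hom C X Y\<^esub> h)"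
    by (intro co_eqD[of X Y]) (auto simp: co_mult mult_closed add.assoc)
next
  fix f assume "f \<in> carrier (Hom C X Y)"
  then show "\<one>\<^bsub>Hom C X Y\<^esub> \<otimes>\<^bsub>Hom C X Y\<^esub> f = f"
    by (intro co_eqD[of X Y]) (auto simp: co_mult co_one mult_closed one_closed)
qed (auto simp: mult_closed one_closed)

text \<open>
  For the untruncated composition this is associativity of convolution. By coherence the inner
  truncations discard only terms that the outer truncation discards as well.
\<close>

lemma Cmp_assoc:
  assumes f: "f \<in> carrier (Hom C W X)" and g: "g \<in> carrier (Hom C X Y)" and h: "h \<in> carrier (Hom C Y Z)"
  shows "Cmp C W X Z (Cmp C X Y Z h g) f = Cmp C W Y Z h (Cmp C W X Y g f)"
proof (rule co_eqD)
  let ?f = "co W X f" and ?g = "co X Y g" and ?h = "co Y Z h"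
  have fin: "finite (supp ?f)" "finite (supp ?g)" "finite (supp ?h)"
    using finite_supp_co f g h by blast+
  have "truncate (pos R W Z) (conv (truncate (pos R X Z) (conv ?h ?g)) ?f) t = truncate (pos R W Z) (conv ?h (truncate (pos R W Y) (conv ?g ?f))) t" for t
  proof (cases "t \<in> pos R W Z")
    case True
    obtain n i j where t: "t = (n, i, j)" by (cases t)
    have n: "j < length W" "i < length Z" "R n (W ! j) (Z ! i)" using True t by (auto simp: pos_iff)
    have "conv (truncate (pos R X Z) (conv ?h ?g)) ?f (n, i, j) = conv (conv ?h ?g) ?f (n, i, j)"
    proof (rule conv_cong[OF _ fin(1) fin(1)])
      fix k l assume 1: "?f (k, l, j) \<noteq> 0 \<or> ?f (k, l, j) \<noteq> 0"
        and "truncate (pos R X Z) (conv ?h ?g) (n - k, i, l) \<noteq> 0 \<or> conv ?h ?g (n - k, i, l) \<noteq> 0"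
      then have "conv ?h ?g (n - k, i, l) \<noteq> 0" by (auto simp: truncate_def split: if_splits)
      then obtain k' l' where 2: "?g (k', l', l) \<noteq> 0" "?h (n - k - k', i, l') \<noteq> 0"
        by (rule conv_nonzeroD)
      have *: "(k, l, j) \<in> pos R W X" "(k', l', l) \<in> pos R X Y" "(n - k - k', i, l') \<in> pos R Y Z"
        using 1 2 co_nonzeroD f g h by blast+
      then have "R (k' + (n - k - k')) (X ! l) (Z ! i)"
        using coherent[of k "W ! j" "X ! l" k' "Y ! l'" "n - k - k'" "Z ! i"] n by (auto simp: pos_iff)
      then have "(n - k, i, l) \<in> pos R X Z" using * by (simp add: pos_iff)
      then show "?f (k, l, j) = ?f (k, l, j) \<and> truncate (pos R X Z) (conv ?h ?g) (n - k, i, l) = conv ?h ?g (n - k, i, l)"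
        by (simp add: truncate_def)
    qed
    also have "\<dots> = conv ?h (conv ?g ?f) (n, i, j)"
      using conv_assoc[OF fin] by simp
    also have "\<dots> = conv ?h (truncate (pos R W Y) (conv ?g ?f)) (n, i, j)"
    proof (rule conv_cong)
      fix k l assume "conv ?g ?f (k, l, j) \<noteq> 0 \<or> truncate (pos R W Y) (conv ?g ?f) (k, l, j) \<noteq> 0"
        and 1: "?h (n - k, i, l) \<noteq> 0 \<or> ?h (n - k, i, l) \<noteq> 0"
      then have "conv ?g ?f (k, l, j) \<noteq> 0" by (auto simp: truncate_def split: if_splits)
      then obtain k' l' where 2: "?f (k', l', j) \<noteq> 0" "?g (k - k', l, l') \<noteq> 0"
        by (rule conv_nonzeroD)
      have *: "(k', l', j) \<in> pos R W X" "(k - k', l, l') \<in> pos R X Y" "(n - k, i, l) \<in> pos R Y Z"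
        using 1 2 co_nonzeroD f g h by blast+
      then have "R (k' + (k - k')) (W ! j) (Y ! l)"
        using coherent[of k' "W ! j" "X ! l'" "k - k'" "Y ! l" "n - k" "Z ! i"] n by (auto simp: pos_iff)
      then have "(k, l, j) \<in> pos R W Y" using * by (simp add: pos_iff)
      then show "conv ?g ?f (k, l, j) = truncate (pos R W Y) (conv ?g ?f) (k, l, j) \<and> ?h (n - k, i, l) = ?h (n - k, i, l)"
        by (simp add: truncate_def)
    qed (auto simp: supp_truncate finite_supp_conv fin)
    finally show ?thesis by (simp add: t truncate_def)
  qed (simp add: truncate_def)
  then show "co W Z (Cmp C W X Z (Cmp C X Y Z h g) f) = co W Z (Cmp C W Y Z h (Cmp C W X Y g f))"
    using f g h by (simp add: co_Cmp Cmp_closed fun_eq_iff)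
qed (use assms in \<open>auto intro!: Cmp_closed\<close>)

lemma Idn_left:
  assumes f: "f \<in> carrier (Hom C X Y)"
  shows "Cmp C X Y Y (Idn C Y) f = f"
proof (rule co_eqD)
  let ?f = "co X Y f" and ?I = "co Y Y (Idn C Y)"
  have "truncate (pos R X Y) (conv ?I ?f) t = ?f t" for t
  proof -
    obtain n i j where [simp]: "t = (n, i, j)" by (cases t)
    show ?thesis
    proof (cases "t \<in> pos R X Y")
      case True
      then have i: "(0, i, i) \<in> pos R Y Y"
        using R_id by (auto simp: pos_iff)
      have "conv ?I ?f t = (\<Sum>(k, l) \<in> {(n, i)}. ?I (n - k, i, l) * ?f (k, l, j))"
        using finite_supp_co[OF f] by (simp only: \<open>t = _\<close>, intro conv_eq_sum) (auto simp: co_Idn truncate_def split: if_splits)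
      then show ?thesis using i True by (simp add: co_Idn truncate_def)
    next
      case False
      then show ?thesis using co_nonzeroD[OF f] by (auto simp: truncate_def)
    qed
  qed
  then show "co X Y (Cmp C X Y Y (Idn C Y) f) = co X Y f"
    using f by (simp add: co_Cmp Idn_closed fun_eq_iff)
qed (auto intro: Cmp_closed Idn_closed f)

end


section \<open>Quotients\<close>

text \<open>
  The basic morphisms that survive when the indecomposables in \<open>I\<close> are made zero.
\<close>

definition avoiding :: "(int \<Rightarrow> 'a \<Rightarrow> 'a \<Rightarrow> bool) \<Rightarrow> 'a set \<Rightarrow> int \<Rightarrow> 'a \<Rightarrow> 'a \<Rightarrow> bool" where
  "avoiding R I n a b \<longleftrightarrow> R n a b \<and> \<not> (\<exists>c \<in> I. \<exists>k. R k a c \<and> R (n - k) c b)"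

lemma pos_avoiding_subset: "pos (avoiding R I) X Y \<subseteq> pos R X Y"
  by (auto simp: pos_def avoiding_def)

context basis_rel
begin

text \<open>
  A factorization of \<open>a \<rightarrow> b\<close> through \<open>I\<close> can be continued along \<open>b \<rightarrow> c\<close>, and coherence makes the
  second factor of the result a basic morphism again.
\<close>

lemma avoiding_left:
  assumes "R k a b" "R l b c" "avoiding R I (k + l) a c"
  shows "avoiding R I k a b"
proof -
  have False if "x \<in> I" "R p a x" "R (k - p) x b" for x p
  proof -
    have "R (k - p + l) x c"
      using coherent[of p a x "k - p" b l c] assms that by (auto simp: avoiding_def)
    then show False
      using assms(3) that by (auto simp: avoiding_def algebra_simps)
  qed
  then show ?thesis using assms by (auto simp: avoiding_def)
qed

lemma avoiding_right:
  assumes "R k a b" "R l b c" "avoiding R I (k + l) a c"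
  shows "avoiding R I l b c"
proof -
  have False if "x \<in> I" "R p b x" "R (l - p) x c" for x p
  proof -
    have "R (k + p) a x"
      using coherent[of k a b p x "l - p" c] assms that by (auto simp: avoiding_def)
    moreover have "k + l - (k + p) = l - p" by simp
    ultimately show False
      using assms(3) that unfolding avoiding_def by metis
  qed
  then show ?thesis using assms by (auto simp: avoiding_def)
qed

lemma basis_rel_avoiding: "basis_rel (avoiding R I)"
proof
  fix k l m a b c d
  assume *: "avoiding R I k a b" "avoiding R I l b c" "avoiding R I m c d" "avoiding R I (k + l + m) a d"
  then have "R (k + l) a c" "R (l + m) b d" 
    using coherent[of k a b l c m d] by (auto simp: avoiding_def)
  then show "avoiding R I (k + l) a c \<and> avoiding R I (l + m) b d"
    using * avoiding_left[of "k + l" a c m d I] avoiding_right[of k a b "l + m" d I]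
    by (auto simp: avoiding_def add.assoc)
next
  fix k a b assume *: "avoiding R I k a b"
  then have "R 0 a a" "R 0 b b"
    using R_id by (auto simp: avoiding_def)
  then show "avoiding R I 0 a a \<and> avoiding R I 0 b b"
    using * avoiding_left[of 0 a a k b I] avoiding_right[of k a b 0 b I] by (auto simp: avoiding_def)
qed

end

context based_cat
begin

text \<open>
  If \<open>f\<close> factors through \<open>I\<close>, then a basic morphism with nonzero coefficient in \<open>f\<close> is a composite of
  basic morphisms through a summand in \<open>I\<close>. Conversely, a morphism that has nonzero coefficients only
  at such places factors through the direct sum of one intermediate object for each of its
  coefficients. In particular the morphisms that factor through \<open>I\<close> form a subgroup.
\<close>

lemma thru_eq_avoiding:
  "thru C {Z. set Z \<subseteq> I} X Y =
     {f \<in> carrier (Hom C X Y). \<forall>t \<in> pos (avoiding R I) X Y. co X Y f t = 0}"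
proof (intro equalityI subsetI)
  fix f assume "f \<in> thru C {Z. set Z \<subseteq> I} X Y"
  then obtain Z g h where f: "f \<in> carrier (Hom C X Y)" and Z: "set Z \<subseteq> I"
    and g: "g \<in> carrier (Hom C X Z)" and h: "h \<in> carrier (Hom C Z Y)" and eq: "f = Cmp C X Z Y h g"
    by (auto simp: thru_def)
  have "co X Y f (n, i, j) = 0" if n: "(n, i, j) \<in> pos (avoiding R I) X Y" for n i j
  proof (rule ccontr)
    assume "co X Y f (n, i, j) \<noteq> 0"
    then have "conv (co Z Y h) (co X Z g) (n, i, j) \<noteq> 0"
      using eq g h by (auto simp: co_Cmp truncate_def split: if_splits)
    then obtain k l where "co X Z g (k, l, j) \<noteq> 0" "co Z Y h (n - k, i, l) \<noteq> 0"
      by (rule conv_nonzeroD)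
    then have "(k, l, j) \<in> pos R X Z" "(n - k, i, l) \<in> pos R Z Y"
      using co_nonzeroD g h by blast+
    moreover from this have "Z ! l \<in> I"
      using Z by (auto simp: pos_iff)
    ultimately show False
      using n by (auto simp: pos_iff avoiding_def)
  qed
  then show "f \<in> {f \<in> carrier (Hom C X Y). \<forall>t \<in> pos (avoiding R I) X Y. co X Y f t = 0}"
    using f by auto
next
  fix f assume "f \<in> {f \<in> carrier (Hom C X Y). \<forall>t \<in> pos (avoiding R I) X Y. co X Y f t = 0}"
  then have f: "f \<in> carrier (Hom C X Y)" and zero: "\<And>t. t \<in> pos (avoiding R I) X Y \<Longrightarrow> co X Y f t = 0"
    by auto
  let ?f = "co X Y f"
  obtain L where L: "set L = supp ?f" "distinct L"
    using finite_distinct_list[OF finite_supp_co[OF f]] by blast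
  have supp_pos: "(n, i, j) \<in> pos R X Y" if "(n, i, j) \<in> supp ?f" for n i j
    using supp_co_subset[OF f] that by auto
  have "\<exists>x k. x \<in> I \<and> R k (X ! snd (snd t)) x \<and> R (fst t - k) x (Y ! fst (snd t))" if "t \<in> supp ?f" for t
  proof -
    obtain n i j where [simp]: "t = (n, i, j)" by (cases t)
    have "(n, i, j) \<in> pos R X Y" "(n, i, j) \<notin> pos (avoiding R I) X Y"
      using that zero[of t] supp_pos by (auto simp: supp_def)
    then show ?thesis by (auto simp: pos_iff avoiding_def)
  qed
  then obtain c a where "\<And>t. t \<in> supp ?f \<Longrightarrow>
      c t \<in> I \<and> R (a t) (X ! snd (snd t)) (c t) \<and> R (fst t - a t) (c t) (Y ! fst (snd t))"
    by metis
  from this[of "(_, _, _)"] have ca: "\<And>n i j. (n, i, j) \<in> supp ?f \<Longrightarrow>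
      c (n, i, j) \<in> I \<and> R (a (n, i, j)) (X ! j) (c (n, i, j)) \<and> R (n - a (n, i, j)) (c (n, i, j)) (Y ! i)"
    by simp
  define Z where "Z = map c L"
  have lenZ: "length Z = length L" by (simp add: Z_def)
  have nthL: "L ! l \<in> supp ?f" if "l < length L" for l
    using that L by (metis nth_mem)
  \<comment> \<open>The factor \<open>X \<rightarrow> Z\<close> carries the coefficients of \<open>f\<close>, and \<open>Z \<rightarrow> Y\<close> has coefficients 0 and 1.\<close>
  define eg where "eg = (\<lambda>(k, l, j). if l < length L \<and> k = a (L ! l) \<and> j = snd (snd (L ! l)) then ?f (L ! l) else 0)"
  define eh where "eh = (\<lambda>(m, i, l). if l < length L \<and> m = fst (L ! l) - a (L ! l) \<and> i = fst (snd (L ! l)) then 1 else 0 :: 'k)"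
  have "supp eg \<subseteq> (\<lambda>l. (a (L ! l), l, snd (snd (L ! l)))) ` {..<length L}"
    by (auto simp: supp_def eg_def split: if_splits)
  then have fin_g: "finite (supp eg)"
    by (meson finite_imageI finite_lessThan finite_subset)
  have "supp eh \<subseteq> (\<lambda>l. (fst (L ! l) - a (L ! l), fst (snd (L ! l)), l)) ` {..<length L}"
    by (auto simp: supp_def eh_def split: if_splits)
  then have fin_h: "finite (supp eh)"
    by (meson finite_imageI finite_lessThan finite_subset)
  have g_pos: "(k, l, j) \<in> pos R X Z" if "eg (k, l, j) \<noteq> 0" for k l j
  proof -
    have l: "l < length L" "k = a (L ! l)" "j = snd (snd (L ! l))"
      using that by (auto simp: eg_def split: if_splits)
    obtain n i j' where t: "L ! l = (n, i, j')" by (cases "L ! l")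
    show ?thesis
      using nthL[OF l(1)] l ca[of n i j'] supp_pos[of n i j'] lenZ by (auto simp: t pos_iff Z_def)
  qed
  then have supp_g: "supp eg \<subseteq> pos R X Z"
    by (auto simp: supp_def)
  have "(m, i, l) \<in> pos R Z Y" if "eh (m, i, l) \<noteq> 0" for m i l
  proof -
    have l: "l < length L" "m = fst (L ! l) - a (L ! l)" "i = fst (snd (L ! l))"
      using that by (auto simp: eh_def split: if_splits)
    obtain n i' j where t: "L ! l = (n, i', j)" by (cases "L ! l")
    show ?thesis
      using nthL[OF l(1)] l ca[of n i' j] supp_pos[of n i' j] lenZ by (auto simp: t pos_iff Z_def)
  qed
  then have supp_h: "supp eh \<subseteq> pos R Z Y"
    by (auto simp: supp_def)
  obtain g where g: "g \<in> carrier (Hom C X Z)" "co X Z g = eg"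
    using ex_co[OF fin_g supp_g] .
  obtain h where h: "h \<in> carrier (Hom C Z Y)" "co Z Y h = eh"
    using ex_co[OF fin_h supp_h] .
  have "truncate (pos R X Y) (conv eh eg) t = ?f t" for t
  proof (cases "t \<in> pos R X Y")
    case True
    obtain n i j where t: "t = (n, i, j)" by (cases t)
    let ?A = "(\<lambda>l. (a (L ! l), l)) ` {..<length L}"
    have "conv eh eg (n, i, j) = (\<Sum>(k, l) \<in> ?A. eh (n - k, i, l) * eg (k, l, j))"
      by (rule conv_eq_sum[OF _ _ fin_g]) (auto simp: eg_def split: if_splits)
    also have "\<dots> = (\<Sum>l < length L. eh (n - a (L ! l), i, l) * eg (a (L ! l), l, j))"
      by (subst sum.reindex) (auto simp: inj_on_def)
    also have "\<dots> = (\<Sum>l < length L. if L ! l = t then ?f t else 0)"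
      by (rule sum.cong) (auto simp: eh_def eg_def t prod_eq_iff split: if_splits)
    also have "\<dots> = (\<Sum>s \<in> set L. if s = t then ?f t else 0)"
      by (rule sum.reindex_bij_betw[OF bij_betw_nth[OF L(2)], where g = "\<lambda>s. if s = t then ?f t else 0"]) auto
    also have "\<dots> = (if t \<in> set L then ?f t else 0)"
      by simp
    also have "\<dots> = ?f t"
      by (simp add: L(1) supp_def)
    finally show ?thesis using True by (simp add: t truncate_def)
  next
    case False
    then show ?thesis using co_nonzeroD[OF f] by (cases t) (auto simp: truncate_def)
  qed
  then have "truncate (pos R X Y) (conv eh eg) = ?f" ..
  then have "f = Cmp C X Z Y h g"
    using f g h by (intro co_eqD[of X Y]) (simp_all add: co_Cmp Cmp_closed)
  moreover have "set Z \<subseteq> I"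
  proof
    fix x assume "x \<in> set Z"
    then obtain t where "t \<in> supp ?f" "x = c t" using L by (auto simp: Z_def)
    then show "x \<in> I" using ca by (cases t) auto
  qed
  ultimately show "f \<in> thru C {Z. set Z \<subseteq> I} X Y"
    using f g h by (auto simp: thru_def)
qed

definition quot_co :: "'a set \<Rightarrow> 'a list \<Rightarrow> 'a list \<Rightarrow> 'm set \<Rightarrow> 'k coeffs" where
  "quot_co I X Y F = truncate (pos (avoiding R I) X Y) (co X Y (SOME f. f \<in> F))"

text \<open>
  The objects in \<open>S\<close> may be given up to isomorphism, as the objects of \<open>add T\<close> are; all that the
  quotient depends on is the set of morphisms that factor through \<open>S\<close>.
\<close>

context
  fixes S I
  assumes thru_S: "\<And>X Y. thru C S X Y = thru C {Z. set Z \<subseteq> I} X Y"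
begin

lemma thru_iff: "f \<in> thru C S X Y \<longleftrightarrow>
    f \<in> carrier (Hom C X Y) \<and> truncate (pos (avoiding R I) X Y) (co X Y f) = (\<lambda>_. 0)"
  by (auto simp: thru_S thru_eq_avoiding truncate_def fun_eq_iff split: if_splits)

lemma thru_subgroup: "subgroup (thru C S X Y) (Hom C X Y)"
proof -
  interpret H: comm_group "Hom C X Y" by (rule comm_group_Hom)
  have zero: "f \<in> thru C S X Y \<longleftrightarrow> f \<in> carrier (Hom C X Y) \<and> (\<forall>t \<in> pos (avoiding R I) X Y. co X Y f t = 0)" for f
    by (simp add: thru_S thru_eq_avoiding)
  show ?thesis
  proof (rule H.subgroupI)
    show "inv\<^bsub>Hom C X Y\<^esub> f \<in> thru C S X Y" if "f \<in> thru C S X Y" for f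
    proof -
      have f: "f \<in> carrier (Hom C X Y)" using that zero by blast
      have "co X Y f t + co X Y (inv\<^bsub>Hom C X Y\<^esub> f) t = 0" for t
        using fun_cong[OF co_mult[of f X Y "inv\<^bsub>Hom C X Y\<^esub> f"], of t] f by (simp add: co_one)
      then have "co X Y (inv\<^bsub>Hom C X Y\<^esub> f) t = 0" if "co X Y f t = 0" for t
        using that by (metis add_0)
      then show ?thesis
        using that f by (simp add: zero)
    qed
    show "thru C S X Y \<noteq> {}"
      using zero[of "\<one>\<^bsub>Hom C X Y\<^esub>"] by (auto simp: co_one one_closed)
  qed (auto simp: zero co_mult mult_closed)
qed

lemma thru_normal: "normal (thru C S X Y) (Hom C X Y)"
  using comm_group.subgroup_imp_normal[OF comm_group_Hom thru_subgroup] .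

text \<open>
  Cosets are thus determined by the coefficients of the surviving basic morphisms, which become the
  coefficients of the quotient category.
\<close>

lemma quot_mor_eq_iff:
  assumes f: "f \<in> carrier (Hom C X Y)" and g: "g \<in> carrier (Hom C X Y)"
  shows "quot_mor C S X Y f = quot_mor C S X Y g \<longleftrightarrow>
      truncate (pos (avoiding R I) X Y) (co X Y f) = truncate (pos (avoiding R I) X Y) (co X Y g)"
proof -
  interpret H: comm_group "Hom C X Y" by (rule comm_group_Hom)
  interpret N: normal "thru C S X Y" "Hom C X Y" by (rule thru_normal)
  let ?d = "f \<otimes>\<^bsub>Hom C X Y\<^esub> inv\<^bsub>Hom C X Y\<^esub> g"
  have "?d \<otimes>\<^bsub>Hom C X Y\<^esub> g = f" using f g by (simp add: H.m_assoc)
  then have d: "co X Y f t = co X Y ?d t + co X Y g t" for t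
    using fun_cong[OF co_mult[of ?d X Y g], of t] f g by simp
  have "quot_mor C S X Y f = quot_mor C S X Y g \<longleftrightarrow> ?d \<in> thru C S X Y"
    unfolding quot_mor_def
  proof
    assume "thru C S X Y #>\<^bsub>Hom C X Y\<^esub> f = thru C S X Y #>\<^bsub>Hom C X Y\<^esub> g"
    then have "thru C S X Y #>\<^bsub>Hom C X Y\<^esub> ?d = thru C S X Y"
      using H.coset_mult_inv2 f g N.subset by blast
    then show "?d \<in> thru C S X Y"
      using H.coset_join1 f g N.subgroup_axioms by blast
  next
    assume "?d \<in> thru C S X Y"
    then have "thru C S X Y #>\<^bsub>Hom C X Y\<^esub> ?d = thru C S X Y"
      using H.coset_join2 f g N.subgroup_axioms by blast
    then show "thru C S X Y #>\<^bsub>Hom C X Y\<^esub> f = thru C S X Y #>\<^bsub>Hom C X Y\<^esub> g"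
      using H.coset_mult_inv1 f g N.subset by blast
  qed
  also have "\<dots> \<longleftrightarrow> truncate (pos (avoiding R I) X Y) (co X Y f) = truncate (pos (avoiding R I) X Y) (co X Y g)"
  proof -
    have "truncate P (co X Y ?d) = (\<lambda>_. 0) \<longleftrightarrow> truncate P (co X Y f) = truncate P (co X Y g)" for P
      unfolding truncate_def fun_eq_iff d by (auto split: if_splits)
    then show ?thesis using f g by (simp add: thru_iff)
  qed
  finally show ?thesis .
qed

lemma mem_quot_mor:
  assumes f: "f \<in> carrier (Hom C X Y)"
  shows "g \<in> quot_mor C S X Y f \<longleftrightarrow> g \<in> carrier (Hom C X Y) \<and> quot_mor C S X Y g = quot_mor C S X Y f"
proof -
  interpret H: comm_group "Hom C X Y" by (rule comm_group_Hom)
  interpret N: normal "thru C S X Y" "Hom C X Y" by (rule thru_normal)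
  show ?thesis
    unfolding quot_mor_def
    using f H.rcos_self[OF _ N.subgroup_axioms] H.repr_independence[OF _ f N.subgroup_axioms]
      H.r_coset_subset_G[OF N.subset f] by blast
qed

lemma quot_mor_closed:
  "f \<in> carrier (Hom C X Y) \<Longrightarrow> quot_mor C S X Y f \<in> carrier (Hom (quot_cat C S) X Y)"
  by (auto simp: quot_cat_def FactGroup_def RCOSETS_def quot_mor_def)

lemma quot_carrierE:
  assumes "F \<in> carrier (Hom (quot_cat C S) X Y)"
  obtains f where "f \<in> carrier (Hom C X Y)" "F = quot_mor C S X Y f"
  using assms by (auto simp: quot_cat_def FactGroup_def RCOSETS_def quot_mor_def)

lemma quot_co_quot_mor:
  assumes f: "f \<in> carrier (Hom C X Y)"
  shows "quot_co I X Y (quot_mor C S X Y f) = truncate (pos (avoiding R I) X Y) (co X Y f)"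
proof -
  let ?g = "SOME g. g \<in> quot_mor C S X Y f"
  have "?g \<in> quot_mor C S X Y f"
    using mem_quot_mor[OF f, of f] f by (auto intro: someI)
  then show ?thesis
    using mem_quot_mor[OF f] quot_mor_eq_iff f by (auto simp: quot_co_def)
qed

text \<open>
  A surviving coefficient of a composite only depends on the surviving coefficients of its factors,
  since a product involving a basic morphism that factors through \<open>I\<close> factors through \<open>I\<close> itself.
\<close>

lemma truncate_Cmp:
  assumes f: "f \<in> carrier (Hom C X Y)" and g: "g \<in> carrier (Hom C Y Z)"
  shows "truncate (pos (avoiding R I) X Z) (co X Z (Cmp C X Y Z g f)) =
     truncate (pos (avoiding R I) X Z)
       (conv (truncate (pos (avoiding R I) Y Z) (co Y Z g)) (truncate (pos (avoiding R I) X Y) (co X Y f)))"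
proof
  fix t :: "int \<times> nat \<times> nat"
  obtain n i j where t: "t = (n, i, j)" by (cases t)
  show "truncate (pos (avoiding R I) X Z) (co X Z (Cmp C X Y Z g f)) t =
     truncate (pos (avoiding R I) X Z)
       (conv (truncate (pos (avoiding R I) Y Z) (co Y Z g)) (truncate (pos (avoiding R I) X Y) (co X Y f))) t"
  proof (cases "t \<in> pos (avoiding R I) X Z")
    case True
    have "conv (co Y Z g) (co X Y f) (n, i, j) =
        conv (truncate (pos (avoiding R I) Y Z) (co Y Z g)) (truncate (pos (avoiding R I) X Y) (co X Y f)) (n, i, j)"
    proof (rule conv_cong)
      fix k l
      assume "co X Y f (k, l, j) \<noteq> 0 \<or> truncate (pos (avoiding R I) X Y) (co X Y f) (k, l, j) \<noteq> 0"
        "co Y Z g (n - k, i, l) \<noteq> 0 \<or> truncate (pos (avoiding R I) Y Z) (co Y Z g) (n - k, i, l) \<noteq> 0"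
      then have "co X Y f (k, l, j) \<noteq> 0" "co Y Z g (n - k, i, l) \<noteq> 0"
        by (auto simp: truncate_def split: if_splits)
      then have *: "(k, l, j) \<in> pos R X Y" "(n - k, i, l) \<in> pos R Y Z"
        using co_nonzeroD f g by blast+
      then have "(k, l, j) \<in> pos (avoiding R I) X Y \<and> (n - k, i, l) \<in> pos (avoiding R I) Y Z"
        using True avoiding_left[of k "X ! j" "Y ! l" "n - k" "Z ! i" I]
          avoiding_right[of k "X ! j" "Y ! l" "n - k" "Z ! i" I] by (auto simp: t pos_iff)
      then show "co X Y f (k, l, j) = truncate (pos (avoiding R I) X Y) (co X Y f) (k, l, j) \<and>
          co Y Z g (n - k, i, l) = truncate (pos (avoiding R I) Y Z) (co Y Z g) (n - k, i, l)"
        by (simp add: truncate_def)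
    qed (auto simp: supp_truncate finite_supp_co f)
    then show ?thesis
      using True pos_avoiding_subset[of R I X Z] f g by (auto simp: t co_Cmp truncate_def)
  qed (simp add: truncate_def)
qed

lemma quot_Cmp:
  assumes f: "f \<in> carrier (Hom C X Y)" and g: "g \<in> carrier (Hom C Y Z)"
  shows "Cmp (quot_cat C S) X Y Z (quot_mor C S Y Z g) (quot_mor C S X Y f) =
    quot_mor C S X Z (Cmp C X Y Z g f)"
proof -
  have *: "quot_mor C S X Z (Cmp C X Y Z g' f') = quot_mor C S X Z (Cmp C X Y Z g f)"
    if "g' \<in> quot_mor C S Y Z g" "f' \<in> quot_mor C S X Y f" for g' f'
  proof -
    have "f' \<in> carrier (Hom C X Y)" "g' \<in> carrier (Hom C Y Z)"
      "truncate (pos (avoiding R I) X Y) (co X Y f') = truncate (pos (avoiding R I) X Y) (co X Y f)"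
      "truncate (pos (avoiding R I) Y Z) (co Y Z g') = truncate (pos (avoiding R I) Y Z) (co Y Z g)"
      using that by (auto simp: mem_quot_mor[OF f] mem_quot_mor[OF g] quot_mor_eq_iff[OF _ f] quot_mor_eq_iff[OF _ g])
    then show ?thesis
      using f g by (simp add: quot_mor_eq_iff Cmp_closed truncate_Cmp)
  qed
  moreover have "f \<in> quot_mor C S X Y f" "g \<in> quot_mor C S Y Z g"
    using f g by (simp_all add: mem_quot_mor)
  ultimately show ?thesis
    unfolding quot_cat_def precat.simps by blast
qed

lemma based_cat_quot: "based_cat (avoiding R I) (quot_cat C S) (quot_co I)"
proof (intro based_cat.intro based_cat_axioms.intro basis_rel_avoiding)
  fix X Y
  interpret N: normal "thru C S X Y" "Hom C X Y" for X Y by (rule thru_normal)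
  have one: "\<one>\<^bsub>Hom (quot_cat C S) X Y\<^esub> = quot_mor C S X Y \<one>\<^bsub>Hom C X Y\<^esub>"
    by (simp add: quot_cat_def quot_mor_def N.coset_mult_one N.subset)
  show "\<one>\<^bsub>Hom (quot_cat C S) X Y\<^esub> \<in> carrier (Hom (quot_cat C S) X Y)"
    by (simp add: one quot_mor_closed one_closed)
  show "quot_co I X Y \<one>\<^bsub>Hom (quot_cat C S) X Y\<^esub> = (\<lambda>_. 0)"
    by (simp add: one quot_co_quot_mor one_closed co_one truncate_def)
  have mult: "quot_mor C S X Y f \<otimes>\<^bsub>Hom (quot_cat C S) X Y\<^esub> quot_mor C S X Y g = quot_mor C S X Y (f \<otimes>\<^bsub>Hom C X Y\<^esub> g)"
    if "f \<in> carrier (Hom C X Y)" "g \<in> carrier (Hom C X Y)" for f g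
    using that by (simp add: quot_cat_def quot_mor_def N.rcos_sum)
  show "F \<otimes>\<^bsub>Hom (quot_cat C S) X Y\<^esub> G \<in> carrier (Hom (quot_cat C S) X Y)"
    "quot_co I X Y (F \<otimes>\<^bsub>Hom (quot_cat C S) X Y\<^esub> G) = (\<lambda>t. quot_co I X Y F t + quot_co I X Y G t)"
    if "F \<in> carrier (Hom (quot_cat C S) X Y)" "G \<in> carrier (Hom (quot_cat C S) X Y)" for F G
    using that
    by (auto elim!: quot_carrierE simp: mult quot_mor_closed mult_closed quot_co_quot_mor co_mult truncate_def fun_eq_iff)
  show "bij_betw (quot_co I X Y) (carrier (Hom (quot_cat C S) X Y))
      {e. finite (supp e) \<and> supp e \<subseteq> pos (avoiding R I) X Y}"
    unfolding bij_betw_def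
  proof (intro conjI equalityI subsetI)
    show "inj_on (quot_co I X Y) (carrier (Hom (quot_cat C S) X Y))"
      by (rule inj_onI, elim quot_carrierE) (simp add: quot_co_quot_mor quot_mor_eq_iff)
    fix e
    show "e \<in> {e. finite (supp e) \<and> supp e \<subseteq> pos (avoiding R I) X Y}"
      if "e \<in> quot_co I X Y ` carrier (Hom (quot_cat C S) X Y)"
      using that by (auto elim!: quot_carrierE simp: quot_co_quot_mor supp_truncate finite_supp_co)
    assume "e \<in> {e. finite (supp e) \<and> supp e \<subseteq> pos (avoiding R I) X Y}"
    then have e: "finite (supp e)" "supp e \<subseteq> pos (avoiding R I) X Y" by auto
    then have "supp e \<subseteq> pos R X Y" using pos_avoiding_subset by blast
    then obtain f where f: "f \<in> carrier (Hom C X Y)" "co X Y f = e"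
      using ex_co e(1) by blast
    have "truncate (pos (avoiding R I) X Y) e = e"
      using e(2) by (auto simp: truncate_def supp_def fun_eq_iff)
    then show "e \<in> quot_co I X Y ` carrier (Hom (quot_cat C S) X Y)"
      using f by (intro image_eqI[of _ _ "quot_mor C S X Y f"]) (auto simp: quot_co_quot_mor quot_mor_closed)
  qed
next
  fix F G X Y Z
  assume "F \<in> carrier (Hom (quot_cat C S) X Y)" "G \<in> carrier (Hom (quot_cat C S) Y Z)"
  then show "Cmp (quot_cat C S) X Y Z G F \<in> carrier (Hom (quot_cat C S) X Z)"
    "quot_co I X Z (Cmp (quot_cat C S) X Y Z G F) =
       truncate (pos (avoiding R I) X Z) (conv (quot_co I Y Z G) (quot_co I X Y F))"
    by (auto elim!: quot_carrierE simp: quot_Cmp quot_mor_closed Cmp_closed quot_co_quot_mor truncate_Cmp)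
next
  fix X
  have Idn: "Idn (quot_cat C S) X = quot_mor C S X X (Idn C X)"
    by (simp add: quot_cat_def)
  show "Idn (quot_cat C S) X \<in> carrier (Hom (quot_cat C S) X X)"
    by (simp add: Idn quot_mor_closed Idn_closed)
  show "quot_co I X X (Idn (quot_cat C S) X) =
      truncate (pos (avoiding R I) X X) (\<lambda>(n, i, j). if n = 0 \<and> i = j then 1 else 0)"
    using pos_avoiding_subset[of R I X X]
    by (auto simp: Idn quot_co_quot_mor Idn_closed co_Idn truncate_def fun_eq_iff)
qed

end

end


section \<open>Doubling and orbit categories\<close>

lemma (in based_cat) based_cat_doubled:
  "based_cat (\<lambda>n a b. R n (fst a) (fst b)) (doubled C) (\<lambda>X Y. co (map fst X) (map fst Y))"
proof -
  have "pos (\<lambda>n a b. R n (fst a) (fst b)) X Y = pos R (map fst X) (map fst Y)" for X Y :: "('a \<times> bool) list"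
    by (auto simp: pos_def)
  then show ?thesis
    by unfold_locales
      (use coherent R_id co_bij in \<open>auto simp: doubled_def one_closed mult_closed co_mult co_one
        Cmp_closed co_Cmp Idn_closed co_Idn\<close>)
qed

lemma (in based_cat) based_cat_full_subcat: "based_cat R (full_subcat C S) co"
  by unfold_locales
    (use coherent R_id co_bij in \<open>auto simp: full_subcat_def one_closed mult_closed co_mult co_one
      Cmp_closed co_Cmp Idn_closed co_Idn\<close>)

lemma (in based_cat) co_finprod:
  assumes "finite A" "f \<in> A \<rightarrow> carrier (Hom C X Y)"
  shows "co X Y (finprod (Hom C X Y) f A) = (\<lambda>t. \<Sum>k \<in> A. co X Y (f k) t)"
proof -
  interpret H: comm_group "Hom C X Y" by (rule comm_group_Hom)
  show ?thesis
    using assms by (induction A) (auto simp: co_one co_mult H.finprod_closed Pi_def fun_eq_iff)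
qed

lemma (in based_cat) co_eq_zero_iff:
  "f \<in> carrier (Hom C X Y) \<Longrightarrow> co X Y f = (\<lambda>_. 0) \<longleftrightarrow> f = \<one>\<^bsub>Hom C X Y\<^esub>"
  using co_eqD[of X Y f "\<one>\<^bsub>Hom C X Y\<^esub>"] by (auto simp: co_one one_closed)

text \<open>
  The basic morphisms all have degree zero before the passage to the orbits; the degree of the orbit
  category then records the power of the automorphism. On coefficients the automorphism acts
  trivially.
\<close>

locale orbit_action = based_cat R C co
  for R :: "int \<Rightarrow> 'a \<Rightarrow> 'a \<Rightarrow> bool" and C :: "('a list, 'm) precat" and co :: "'a list \<Rightarrow> 'a list \<Rightarrow> 'm \<Rightarrow> 'k::field coeffs" +
  fixes \<phi> :: "int \<Rightarrow> 'a \<Rightarrow> 'a" and FM :: "int \<Rightarrow> 'a list \<Rightarrow> 'a list \<Rightarrow> 'm \<Rightarrow> 'm"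
  assumes degree_zero: "R n a b \<Longrightarrow> n = 0"
    and action_add: "\<phi> k (\<phi> l a) = \<phi> (k + l) a"
    and action_zero: "\<phi> 0 a = a"
    and R_invariant: "R 0 (\<phi> k a) (\<phi> k b) \<longleftrightarrow> R 0 a b"
    and FM_closed: "f \<in> carrier (Hom C X Y) \<Longrightarrow> FM k X Y f \<in> carrier (Hom C (map (\<phi> k) X) (map (\<phi> k) Y))"
    and co_FM: "f \<in> carrier (Hom C X Y) \<Longrightarrow> co (map (\<phi> k) X) (map (\<phi> k) Y) (FM k X Y f) = co X Y f"
begin

abbreviation FO :: "int \<Rightarrow> 'a list \<Rightarrow> 'a list" where
  "FO k \<equiv> map (\<phi> k)"

abbreviation OC :: "('a list, int \<Rightarrow> 'm) precat" where
  "OC \<equiv> orbit_cat C FO FM"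

definition orbit_rel :: "int \<Rightarrow> 'a \<Rightarrow> 'a \<Rightarrow> bool" where
  "orbit_rel n a b \<longleftrightarrow> R 0 a (\<phi> n b)"

definition orbit_co :: "'a list \<Rightarrow> 'a list \<Rightarrow> (int \<Rightarrow> 'm) \<Rightarrow> 'k coeffs" where
  "orbit_co X Y f = (\<lambda>(n, i, j). co X (FO n Y) (f n) (0, i, j))"

lemma FO_diff: "FO k (FO (n - k) X) = FO n X"
  by (simp add: action_add)

lemma orbit_carrier: "f \<in> carrier (Hom OC X Y) \<longleftrightarrow>
    (\<forall>k. f k \<in> carrier (Hom C X (FO k Y))) \<and> finite {k. f k \<noteq> \<one>\<^bsub>Hom C X (FO k Y)\<^esub>}"
proof -
  have "group (Hom C X (FO k Y))" for k
    using comm_group_Hom comm_group.axioms(2) by blast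
  then show ?thesis
    by (simp add: orbit_cat_def carrier_sum_group PiE_UNIV_domain Pi_iff)
qed

lemma orbit_group: "group (Hom OC X Y)"
  unfolding orbit_cat_def using comm_group_Hom comm_group.axioms(2) by (auto intro!: sum_group)

lemma orbit_one: "\<one>\<^bsub>Hom OC X Y\<^esub> = (\<lambda>k. \<one>\<^bsub>Hom C X (FO k Y)\<^esub>)"
  by (simp add: orbit_cat_def restrict_def)

lemma orbit_mult: "f \<otimes>\<^bsub>Hom OC X Y\<^esub> g = (\<lambda>k. f k \<otimes>\<^bsub>Hom C X (FO k Y)\<^esub> g k)"
  by (simp add: orbit_cat_def restrict_def)

lemma basis_rel_orbit: "basis_rel orbit_rel"
proof
  fix k l m a b c d
  assume "orbit_rel k a b" "orbit_rel l b c" "orbit_rel m c d" "orbit_rel (k + l + m) a d"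
  then have "R 0 a (\<phi> k b)" "R 0 (\<phi> k b) (\<phi> (k + l) c)" "R 0 (\<phi> (k + l) c) (\<phi> (k + l + m) d)" "R 0 a (\<phi> (k + l + m) d)"
    using R_invariant[of k b "\<phi> l c"] R_invariant[of "k + l" c "\<phi> m d"] by (auto simp: orbit_rel_def action_add)
  then have "R 0 a (\<phi> (k + l) c)" "R 0 (\<phi> k b) (\<phi> k (\<phi> (l + m) d))"
    using coherent[of 0 a "\<phi> k b" 0 "\<phi> (k + l) c" 0 "\<phi> (k + l + m) d"] by (auto simp: action_add add.assoc)
  then show "orbit_rel (k + l) a c \<and> orbit_rel (l + m) b d"
    by (simp add: orbit_rel_def R_invariant)
next
  fix k a b assume "orbit_rel k a b"
  then have "R 0 a a" "R 0 (\<phi> k b) (\<phi> k b)"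
    using R_id by (auto simp: orbit_rel_def)
  then show "orbit_rel 0 a a \<and> orbit_rel 0 b b"
    by (simp add: orbit_rel_def action_zero R_invariant)
qed

lemma pos_orbit: "(n, i, j) \<in> pos orbit_rel X Y \<longleftrightarrow> (0, i, j) \<in> pos R X (FO n Y)"
  by (auto simp: pos_iff orbit_rel_def)

lemma co_degree: "f \<in> carrier (Hom C X Y) \<Longrightarrow> n \<noteq> 0 \<Longrightarrow> co X Y f (n, i, j) = 0"
  using co_nonzeroD[of f X Y n i j] degree_zero by (auto simp: pos_iff)

lemma orbit_co_supp:
  assumes f: "f \<in> carrier (Hom OC X Y)"
  shows "finite (supp (orbit_co X Y f))" "supp (orbit_co X Y f) \<subseteq> pos orbit_rel X Y"
proof -
  let ?K = "{k. f k \<noteq> \<one>\<^bsub>Hom C X (FO k Y)\<^esub>}"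
  have f': "finite ?K" "\<And>k. f k \<in> carrier (Hom C X (FO k Y))"
    using f by (auto simp: orbit_carrier)
  have "supp (orbit_co X Y f) \<subseteq> (\<Union>k \<in> ?K. (\<lambda>(_, i, j). (k, i, j)) ` supp (co X (FO k Y) (f k)))"
  proof
    fix t assume t: "t \<in> supp (orbit_co X Y f)"
    obtain n i j where [simp]: "t = (n, i, j)" by (cases t)
    have "co X (FO n Y) (f n) (0, i, j) \<noteq> 0" using t by (simp add: supp_def orbit_co_def)
    then have "n \<in> ?K" "(0, i, j) \<in> supp (co X (FO n Y) (f n))"
      by (auto simp: co_one supp_def)
    then show "t \<in> (\<Union>k \<in> ?K. (\<lambda>(_, i, j). (k, i, j)) ` supp (co X (FO k Y) (f k)))"
      by force
  qed
  then show "finite (supp (orbit_co X Y f))"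
    by (rule finite_subset) (use f' finite_supp_co in auto)
  show "supp (orbit_co X Y f) \<subseteq> pos orbit_rel X Y"
    using co_nonzeroD[OF f'(2)] by (auto simp: supp_def orbit_co_def pos_orbit)
qed

lemma orbit_co_inj:
  assumes "f \<in> carrier (Hom OC X Y)" "g \<in> carrier (Hom OC X Y)" "orbit_co X Y f = orbit_co X Y g"
  shows "f = g"
proof
  fix k
  have c: "f k \<in> carrier (Hom C X (FO k Y))" "g k \<in> carrier (Hom C X (FO k Y))"
    using assms by (auto simp: orbit_carrier)
  have "co X (FO k Y) (f k) (n, i, j) = co X (FO k Y) (g k) (n, i, j)" for n i j
  proof (cases "n = 0")
    case True
    then show ?thesis using fun_cong[OF assms(3), of "(k, i, j)"] by (simp add: orbit_co_def)
  qed (simp add: co_degree c)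
  then have "co X (FO k Y) (f k) = co X (FO k Y) (g k)"
    by auto
  then show "f k = g k"
    using c by (rule co_eqD)
qed

lemma orbit_ex_co:
  assumes e: "finite (supp e)" "supp e \<subseteq> pos orbit_rel X Y"
  shows "\<exists>f \<in> carrier (Hom OC X Y). orbit_co X Y f = e"
proof -
  define e' where "e' k = (\<lambda>(n :: int, i, j). if n = 0 then e (k, i, j) else 0)" for k :: int
  have "\<forall>k. \<exists>f. f \<in> carrier (Hom C X (FO k Y)) \<and> co X (FO k Y) f = e' k"
  proof
    fix k
    have "supp (e' k) \<subseteq> (\<lambda>(_, i, j). (0, i, j)) ` supp e"
      by (force simp: supp_def e'_def split: if_splits)
    then have "finite (supp (e' k))" using e(1) by (meson finite_imageI finite_subset)
    moreover have "supp (e' k) \<subseteq> pos R X (FO k Y)"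
    proof
      fix t assume t: "t \<in> supp (e' k)"
      obtain n i j where [simp]: "t = (n, i, j)" by (cases t)
      have "n = 0" "(k, i, j) \<in> supp e" using t by (auto simp: supp_def e'_def split: if_splits)
      then show "t \<in> pos R X (FO k Y)" using e(2) pos_orbit by auto
    qed
    ultimately show "\<exists>f. f \<in> carrier (Hom C X (FO k Y)) \<and> co X (FO k Y) f = e' k"
      by (meson ex_co)
  qed
  from choice[OF this] obtain f where f: "\<And>k. f k \<in> carrier (Hom C X (FO k Y))" "\<And>k. co X (FO k Y) (f k) = e' k"
    by blast
  have "{k. f k \<noteq> \<one>\<^bsub>Hom C X (FO k Y)\<^esub>} \<subseteq> fst ` supp e"
  proof
    fix k assume "k \<in> {k. f k \<noteq> \<one>\<^bsub>Hom C X (FO k Y)\<^esub>}"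
    then have "e' k \<noteq> (\<lambda>_. 0)" using co_eq_zero_iff[OF f(1)[of k]] by (simp add: f(2))
    then obtain i j where "e (k, i, j) \<noteq> 0" by (auto simp: e'_def fun_eq_iff split: if_splits)
    then show "k \<in> fst ` supp e" by (force simp: supp_def)
  qed
  then have "finite {k. f k \<noteq> \<one>\<^bsub>Hom C X (FO k Y)\<^esub>}"
    using e(1) by (meson finite_imageI finite_subset)
  moreover have "orbit_co X Y f = e"
    by (auto simp: orbit_co_def f(2) e'_def)
  ultimately show ?thesis
    using f(1) by (auto simp: orbit_carrier)
qed

text \<open>
  The coefficients of a composite in the orbit category: for fixed degree \<open>n\<close> the sum over the degrees
  \<open>k\<close> of the first factor supplies the degree part of the convolution, and composition of \<open>f k\<close> with the
  translate of \<open>g (n - k)\<close> supplies the summation over the summands of \<open>Y\<close>.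
\<close>

context
  fixes X Y Z f g
  assumes f: "f \<in> carrier (Hom OC X Y)" and g: "g \<in> carrier (Hom OC Y Z)"
begin

private definition K where "K = {k. f k \<noteq> \<one>\<^bsub>Hom C X (FO k Y)\<^esub>}"

private definition term_at where
  "term_at n k = Cmp C X (FO k Y) (FO n Z) (FM k Y (FO (n - k) Z) (g (n - k))) (f k)"

private lemma f_closed: "f k \<in> carrier (Hom C X (FO k Y))" and finite_K: "finite K"
  and g_closed: "g k \<in> carrier (Hom C Y (FO k Z))"
  using f g by (auto simp: orbit_carrier K_def)

private lemma FM_g_closed: "FM k Y (FO (n - k) Z) (g (n - k)) \<in> carrier (Hom C (FO k Y) (FO n Z))"
  using FM_closed[OF g_closed, of k "n - k"] by (simp only: FO_diff)

private lemma co_FM_g: "co (FO k Y) (FO n Z) (FM k Y (FO (n - k) Z) (g (n - k))) = co Y (FO (n - k) Z) (g (n - k))"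
  using co_FM[OF g_closed, of k "n - k"] by (simp only: FO_diff)

private lemma term_closed: "term_at n k \<in> carrier (Hom C X (FO n Z))"
  unfolding term_at_def by (rule Cmp_closed[OF f_closed FM_g_closed])

private lemma co_term: "co X (FO n Z) (term_at n k) (0, i, j) = (if (n, i, j) \<in> pos orbit_rel X Z then
    (\<Sum>l < length Y. orbit_co Y Z g (n - k, i, l) * orbit_co X Y f (k, l, j)) else 0)"
proof -
  have "conv (co Y (FO (n - k) Z) (g (n - k))) (co X (FO k Y) (f k)) (0, i, j) =
      (\<Sum>(m, l) \<in> {0} \<times> {..<length Y}. co Y (FO (n - k) Z) (g (n - k)) (0 - m, i, l) * co X (FO k Y) (f k) (m, l, j))"
  proof (rule conv_eq_sum[OF _ _ finite_supp_co[OF f_closed]])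
    fix m l assume "co X (FO k Y) (f k) (m, l, j) \<noteq> 0"
    then have "(m, l, j) \<in> pos R X (FO k Y)"
      by (rule co_nonzeroD[OF f_closed])
    then show "(m, l) \<in> {0} \<times> {..<length Y}"
      using degree_zero by (auto simp: pos_iff)
  qed simp
  also have "\<dots> = (\<Sum>l < length Y. orbit_co Y Z g (n - k, i, l) * orbit_co X Y f (k, l, j))"
    by (simp add: sum.cartesian_product[symmetric] orbit_co_def)
  finally show ?thesis
    by (simp add: term_at_def co_Cmp[OF f_closed FM_g_closed] co_FM_g truncate_def pos_orbit)
qed

private lemma Cmp_at: "Cmp OC X Y Z g f n = finprod (Hom C X (FO n Z)) (term_at n) K"
  by (simp add: orbit_cat_def K_def term_at_def[abs_def])

private lemma Cmp_at_closed: "Cmp OC X Y Z g f n \<in> carrier (Hom C X (FO n Z))"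
  unfolding Cmp_at using term_closed
  by (intro comm_monoid.finprod_closed comm_group.axioms(1)[OF comm_group_Hom]) auto

lemma orbit_co_Cmp: "orbit_co X Z (Cmp OC X Y Z g f) = truncate (pos orbit_rel X Z) (conv (orbit_co Y Z g) (orbit_co X Y f))"
proof -
  have "orbit_co X Z (Cmp OC X Y Z g f) (n, i, j) =
      truncate (pos orbit_rel X Z) (conv (orbit_co Y Z g) (orbit_co X Y f)) (n, i, j)" for n i j
  proof -
    have "conv (orbit_co Y Z g) (orbit_co X Y f) (n, i, j) =
        (\<Sum>(k, l) \<in> K \<times> {..<length Y}. orbit_co Y Z g (n - k, i, l) * orbit_co X Y f (k, l, j))"
    proof (rule conv_eq_sum)
      fix k l assume *: "orbit_co X Y f (k, l, j) \<noteq> 0"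
      then have "k \<in> K" by (auto simp: orbit_co_def K_def co_one)
      moreover have "l < length Y" using * orbit_co_supp(2)[OF f] by (auto simp: supp_def pos_def)
      ultimately show "(k, l) \<in> K \<times> {..<length Y}" by simp
    qed (use finite_K orbit_co_supp(1)[OF f] in auto)
    moreover have "orbit_co X Z (Cmp OC X Y Z g f) (n, i, j) = (\<Sum>k \<in> K. co X (FO n Z) (term_at n k) (0, i, j))"
      using term_closed by (simp add: orbit_co_def Cmp_at co_finprod finite_K)
    ultimately show ?thesis
      by (simp add: co_term truncate_def sum.cartesian_product)
  qed
  then show ?thesis by auto
qed

lemma orbit_Cmp_closed: "Cmp OC X Y Z g f \<in> carrier (Hom OC X Z)"
proof -
  let ?c = "truncate (pos orbit_rel X Z) (conv (orbit_co Y Z g) (orbit_co X Y f))"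
  have "{n. Cmp OC X Y Z g f n \<noteq> \<one>\<^bsub>Hom C X (FO n Z)\<^esub>} \<subseteq> fst ` supp ?c"
  proof
    fix n assume "n \<in> {n. Cmp OC X Y Z g f n \<noteq> \<one>\<^bsub>Hom C X (FO n Z)\<^esub>}"
    then have "co X (FO n Z) (Cmp OC X Y Z g f n) \<noteq> (\<lambda>_. 0)"
      using co_eq_zero_iff[OF Cmp_at_closed] by blast
    then obtain t where "co X (FO n Z) (Cmp OC X Y Z g f n) t \<noteq> 0"
      by blast
    then obtain m i j where mij: "co X (FO n Z) (Cmp OC X Y Z g f n) (m, i, j) \<noteq> 0"
      by (cases t) auto
    then have "m = 0" using co_degree[OF Cmp_at_closed] by blast
    then have "?c (n, i, j) \<noteq> 0"
      using mij fun_cong[OF orbit_co_Cmp, of "(n, i, j)"] by (simp add: orbit_co_def)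
    then show "n \<in> fst ` supp ?c" by (force simp: supp_def)
  qed
  moreover have "finite (supp ?c)"
    using orbit_co_supp(1)[OF f] orbit_co_supp(1)[OF g] by (simp add: supp_truncate finite_supp_conv)
  ultimately show ?thesis
    using Cmp_at_closed by (auto simp: orbit_carrier intro: finite_subset)
qed

end

lemma orbit_mor_closed:
  assumes "f \<in> carrier (Hom C X Y)"
  shows "orbit_mor C FO X Y f \<in> carrier (Hom OC X Y)"
proof -
  have "FO 0 Y = Y" by (simp add: action_zero map_idI)
  moreover have "{k. orbit_mor C FO X Y f k \<noteq> \<one>\<^bsub>Hom C X (FO k Y)\<^esub>} \<subseteq> {0}"
    by (auto simp: orbit_mor_def)
  ultimately show ?thesis
    using assms by (auto simp: orbit_carrier orbit_mor_def one_closed intro: finite_subset)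
qed

lemma orbit_co_orbit_mor:
  assumes "f \<in> carrier (Hom C X Y)"
  shows "orbit_co X Y (orbit_mor C FO X Y f) = co X Y f"
proof -
  have "FO 0 Y = Y" by (simp add: action_zero map_idI)
  then show ?thesis
    using assms co_degree by (auto simp: orbit_co_def orbit_mor_def fun_eq_iff co_one)
qed

lemma based_cat_orbit: "based_cat orbit_rel OC orbit_co"
proof (intro based_cat.intro based_cat_axioms.intro basis_rel_orbit)
  fix X Y
  interpret G: group "Hom OC X Y" by (rule orbit_group)
  show "\<one>\<^bsub>Hom OC X Y\<^esub> \<in> carrier (Hom OC X Y)" by (rule G.one_closed)
  show "orbit_co X Y \<one>\<^bsub>Hom OC X Y\<^esub> = (\<lambda>_. 0)"
    by (simp add: orbit_one orbit_co_def co_one fun_eq_iff)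
  show "f \<otimes>\<^bsub>Hom OC X Y\<^esub> g \<in> carrier (Hom OC X Y)"
    "orbit_co X Y (f \<otimes>\<^bsub>Hom OC X Y\<^esub> g) = (\<lambda>t. orbit_co X Y f t + orbit_co X Y g t)"
    if "f \<in> carrier (Hom OC X Y)" "g \<in> carrier (Hom OC X Y)" for f g
  proof -
    show "f \<otimes>\<^bsub>Hom OC X Y\<^esub> g \<in> carrier (Hom OC X Y)"
      using that by (rule G.m_closed)
    show "orbit_co X Y (f \<otimes>\<^bsub>Hom OC X Y\<^esub> g) = (\<lambda>t. orbit_co X Y f t + orbit_co X Y g t)"
      using that by (simp add: orbit_carrier orbit_mult orbit_co_def co_mult fun_eq_iff)
  qed
  show "bij_betw (orbit_co X Y) (carrier (Hom OC X Y)) {e. finite (supp e) \<and> supp e \<subseteq> pos orbit_rel X Y}"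
    unfolding bij_betw_def
  proof (intro conjI equalityI subsetI)
    show "inj_on (orbit_co X Y) (carrier (Hom OC X Y))"
      by (rule inj_onI) (rule orbit_co_inj)
    fix e
    show "e \<in> {e. finite (supp e) \<and> supp e \<subseteq> pos orbit_rel X Y}"
      if "e \<in> orbit_co X Y ` carrier (Hom OC X Y)"
      using that orbit_co_supp by (elim imageE) simp
    show "e \<in> orbit_co X Y ` carrier (Hom OC X Y)"
      if "e \<in> {e. finite (supp e) \<and> supp e \<subseteq> pos orbit_rel X Y}"
      using orbit_ex_co[of e X Y] that by (simp add: image_iff) metis
  qed
next
  fix X
  show "Idn OC X \<in> carrier (Hom OC X X)"
    using orbit_mor_closed[OF Idn_closed, of X] by (simp add: orbit_cat_def)
  have "orbit_co X X (Idn OC X) = co X X (Idn C X)"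
    using orbit_co_orbit_mor[OF Idn_closed] by (simp add: orbit_cat_def)
  then show "orbit_co X X (Idn OC X) = truncate (pos orbit_rel X X) (\<lambda>(n, i, j). if n = 0 \<and> i = j then 1 else 0)"
    by (auto simp: co_Idn truncate_def fun_eq_iff pos_iff orbit_rel_def action_zero dest: degree_zero)
qed (rule orbit_Cmp_closed orbit_co_Cmp; assumption)+

end


section \<open>The dyadic triangulation\<close>

text \<open>
  Circumference 2 is used for the circle, so that all vertices are dyadic numbers. A chord with end
  points \<open>t\<close> and \<open>u\<close> modulo 2 is represented with \<open>t < u < t + 2\<close>; the two disjuncts are its two
  orientations.
\<close>

definition edge :: "real \<Rightarrow> real \<Rightarrow> bool" where
  "edge t u \<longleftrightarrow> (\<exists>(m::int) (n::nat). (t = (of_int m - 1) / 2 ^ n \<and> u = of_int m / 2 ^ n) \<or>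
     (t = of_int m / 2 ^ n \<and> u = (of_int m - 1) / 2 ^ n + 2))"

lemma edge_consecutive: "edge ((of_int m - 1) / 2 ^ n) (of_int m / 2 ^ n)"
  and edge_complement: "edge (of_int m / 2 ^ n) ((of_int m - 1) / 2 ^ n + 2)"
  unfolding edge_def by blast+

text \<open>
  The coarsest level with a vertex in each of the gaps \<open>(y' - 2, x)\<close> and \<open>(x', y)\<close> gives a separating
  chord. At level 0 the vertices are the integers, and the vertices in the two gaps are consecutive.
  At a later level one of the gaps has no vertex of the level before, so it contains a single vertex,
  which is odd. Each neighbour of that vertex either lies in the other gap, and then the side joining
  them separates the arcs, or it lies on the adjacent arc. If both neighbours lie on the arcs, the
  chord of the previous level that joins them connects the arcs, which is excluded.
\<close>

lemma separating_edge:
  fixes x x' y y' :: real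
  assumes I: "x \<le> x'" "x' < y" "y \<le> y'" "y' < x + 2"
    and no_edge: "\<And>t u. edge t u \<Longrightarrow> x \<le> t \<Longrightarrow> t \<le> x' \<Longrightarrow> y \<le> u \<Longrightarrow> u \<le> y' \<Longrightarrow> False"
  obtains t u where "edge t u" "y' - 2 < t" "t < x" "x' < u" "u < y"
proof -
  define between where "between n lo hi \<longleftrightarrow> (\<exists>a::int. lo < of_int a / 2 ^ n \<and> of_int a / 2 ^ n < hi)" for n :: nat and lo hi :: real
  have dense: "\<exists>N. \<forall>n \<ge> N. between n lo hi" if lt: "lo < hi" for lo hi
  proof -
    obtain N where N: "1 / (hi - lo) < 2 ^ N"
      using real_arch_pow[of 2 "1 / (hi - lo)"] by auto
    have "between n lo hi" if "N \<le> n" for n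
    proof -
      have "(2::real) ^ N \<le> 2 ^ n" using that by (simp add: power_increasing)
      then have "1 / (hi - lo) < 2 ^ n" using N by linarith
      then have "1 < (hi - lo) * 2 ^ n" using lt by (simp add: field_simps)
      then have "lo * 2 ^ n < of_int (\<lfloor>lo * 2 ^ n\<rfloor> + 1)" "of_int (\<lfloor>lo * 2 ^ n\<rfloor> + 1) < hi * 2 ^ n"
        by (auto simp: algebra_simps) linarith+
      then show ?thesis
        unfolding between_def by (intro exI[of _ "\<lfloor>lo * 2 ^ n\<rfloor> + 1"]) (simp add: field_simps)
    qed
    then show ?thesis by blast
  qed
  let ?P = "\<lambda>n. between n (y' - 2) x \<and> between n x' y"
  obtain N1 N2 where "\<forall>n \<ge> N1. between n (y' - 2) x" "\<forall>n \<ge> N2. between n x' y"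
    using dense[of "y' - 2" x] dense[of x' y] I by auto
  then have "?P (max N1 N2)" by simp
  then obtain n where Pn: "?P n" and least: "\<And>k. k < n \<Longrightarrow> \<not> ?P k"
    using exists_least_iff[of ?P] by blast
  obtain a b :: int where a: "y' - 2 < of_int a / 2 ^ n" "of_int a / 2 ^ n < x"
    and b: "x' < of_int b / 2 ^ n" "of_int b / 2 ^ n < y"
    using Pn by (auto simp: between_def)
  define N where "N = (2::real) ^ n"
  have N: "N > 0" by (simp add: N_def)
  have ab: "a < b" "b < a + 2 * 2 ^ n"
  proof -
    have "of_int a / N < of_int b / N" using a b I by (simp add: N_def)
    then show "a < b" using N by (simp add: divide_less_cancel)
    have "of_int b / N < of_int a / N + 2" using a b I by (simp add: N_def)
    then have "real_of_int b < of_int (a + 2 * 2 ^ n)" using N by (simp add: N_def field_simps)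
    then show "b < a + 2 * 2 ^ n" by (simp only: of_int_less_iff)
  qed
  have order: "(of_int c :: real) / 2 ^ n \<le> of_int d / 2 ^ n" if "c \<le> d" for c d :: int
    using that by (simp add: divide_right_mono)
  show thesis
  proof (cases n)
    case 0
    then have "b = a + 1" using ab by simp
    then have "edge (of_int a) (of_int b)" using edge_consecutive[of b 0] by simp
    then show thesis using that[of "of_int a" "of_int b"] a b by (simp add: 0)
  next
    case (Suc k)
    have half: "\<exists>m. c + 1 = 2 * m \<and> (of_int (c + 1) :: real) / 2 ^ n = of_int m / 2 ^ k \<and>
        (of_int (c - 1) :: real) / 2 ^ n = (of_int m - 1) / 2 ^ k" if "odd c" for c :: int
    proof -
      obtain d where "c = 2 * d + 1" using \<open>odd c\<close> by (rule oddE)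
      then show ?thesis by (intro exI[of _ "d + 1"]) (simp add: Suc field_simps)
    qed
    have even: "between k lo hi" if "even c" "lo < of_int c / 2 ^ n" "of_int c / 2 ^ n < hi" for lo hi and c :: int
    proof -
      obtain d where "c = 2 * d" using \<open>even c\<close> by blast
      then show ?thesis using that by (auto simp: between_def Suc)
    qed
    \<comment> \<open>The cases are mirror images; in the first, the gap before the arc from \<open>x\<close> has no vertex at the previous level.\<close>
    consider "\<not> between k (y' - 2) x" | "\<not> between k x' y"
      using least[of k] Suc by auto
    then show thesis
    proof cases
      case 1
      then have odd: "odd a" "\<not> (y' - 2 < of_int (a - 1) / 2 ^ n \<and> of_int (a - 1) / 2 ^ n < x)"
          "\<not> (y' - 2 < of_int (a + 1) / 2 ^ n \<and> of_int (a + 1) / 2 ^ n < x)"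
        using even[of a "y' - 2" x] even[of "a - 1" "y' - 2" x] even[of "a + 1" "y' - 2" x] a by auto
      have nb: "of_int (a - 1) / 2 ^ n \<le> y' - 2" "x \<le> of_int (a + 1) / 2 ^ n"
        using odd a order[of "a - 1" a] order[of a "a + 1"] by auto
      show thesis
      proof (cases "x' < of_int (a + 1) / 2 ^ n")
        case True
        moreover have "of_int (a + 1) / 2 ^ n < y"
          using order[of "a + 1" b] ab b by simp
        ultimately show thesis
          using edge_consecutive[of "a + 1" n] a by (intro that[of "of_int a / 2 ^ n" "of_int (a + 1) / 2 ^ n"]) auto
      next
        case left: False
        have b': "of_int b / 2 ^ n \<le> of_int (a - 1) / 2 ^ n + (2::real)"
          using order[of b "a - 1 + 2 * 2 ^ n"] ab by (simp add: add_divide_distrib)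
        show thesis
        proof (cases "of_int (a - 1) / 2 ^ n + 2 < y")
          case True
          then show thesis
            using edge_complement[of a n] a b b' by (intro that[of "of_int a / 2 ^ n" "of_int (a - 1) / 2 ^ n + 2"]) auto
        next
          case False
          obtain m where "of_int (a + 1) / 2 ^ n = (of_int m / 2 ^ k :: real)" "of_int (a - 1) / 2 ^ n = ((of_int m - 1) / 2 ^ k :: real)"
            using half[OF odd(1)] by blast
          then have "edge (of_int (a + 1) / 2 ^ n) (of_int (a - 1) / 2 ^ n + 2)"
            using edge_complement[of m k] by simp
          then show thesis
            using no_edge False left nb by fastforce
        qed
      qed
    next
      case 2
      then have odd: "odd b" "\<not> (x' < of_int (b - 1) / 2 ^ n \<and> of_int (b - 1) / 2 ^ n < y)"
          "\<not> (x' < of_int (b + 1) / 2 ^ n \<and> of_int (b + 1) / 2 ^ n < y)"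
        using even[of b x' y] even[of "b - 1" x' y] even[of "b + 1" x' y] b by auto
      have nb: "of_int (b - 1) / 2 ^ n \<le> x'" "y \<le> of_int (b + 1) / 2 ^ n"
        using odd b order[of "b - 1" b] order[of b "b + 1"] by auto
      show thesis
      proof (cases "of_int (b - 1) / 2 ^ n < x")
        case True
        moreover have "y' - 2 < of_int (b - 1) / 2 ^ n"
          using order[of a "b - 1"] ab a by simp
        ultimately show thesis
          using edge_consecutive[of b n] b by (intro that[of "of_int (b - 1) / 2 ^ n" "of_int b / 2 ^ n"]) auto
      next
        case left: False
        have a': "of_int (b + 1) / 2 ^ n \<le> of_int a / 2 ^ n + (2::real)"
          using order[of "b + 1" "a + 2 * 2 ^ n"] ab by (simp add: add_divide_distrib)
        show thesis
        proof (cases "y' < of_int (b + 1) / 2 ^ n")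
          case True
          let ?m = "b + 1 - 2 * 2 ^ n"
          have "of_int ?m / 2 ^ n = of_int (b + 1) / 2 ^ n - (2::real)" "(of_int ?m - 1) / 2 ^ n + (2::real) = of_int b / 2 ^ n"
            by (simp_all add: field_simps)
          then have "edge (of_int (b + 1) / 2 ^ n - 2) (of_int b / 2 ^ n)"
            using edge_complement[of ?m n] by simp
          then show thesis
            using True a a' b by (intro that[of "of_int (b + 1) / 2 ^ n - 2" "of_int b / 2 ^ n"]) auto
        next
          case False
          obtain m where "of_int (b + 1) / 2 ^ n = (of_int m / 2 ^ k :: real)" "of_int (b - 1) / 2 ^ n = ((of_int m - 1) / 2 ^ k :: real)"
            using half[OF odd(1)] by blast
          then have "edge (of_int (b - 1) / 2 ^ n) (of_int (b + 1) / 2 ^ n)"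
            using edge_consecutive[of m k] by simp
          then show thesis
            using no_edge False left nb by fastforce
        qed
      qed
    qed
  qed
qed

lemma dyadic_refine:
  assumes "n \<le> (k::nat)"
  shows "\<exists>d::int. (of_int c :: real) / 2 ^ n = of_int d / 2 ^ k"
proof -
  have "(2::real) ^ k = 2 ^ (k - n) * 2 ^ n" using assms by (simp flip: power_add)
  then show ?thesis by (intro exI[of _ "c * 2 ^ (k - n)"]) (simp add: field_simps)
qed

lemma no_dyadic_between:
  assumes "n \<le> (k::nat)" "(of_int m - 1) / 2 ^ k < (of_int c :: real) / 2 ^ n" "(of_int c :: real) / 2 ^ n < of_int m / 2 ^ k"
  shows False
proof -
  obtain d :: int where "(of_int c :: real) / 2 ^ n = of_int d / 2 ^ k"
    using dyadic_refine assms(1) by blast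
  then have "real_of_int (m - 1) < of_int d" "real_of_int d < of_int m"
    using assms(2,3) by (simp_all add: divide_less_cancel)
  then have "m - 1 < d" "d < m"
    by (simp_all only: of_int_less_iff)
  then show False by simp
qed

text \<open>
  The end points of the coarser of two chords are vertices of the finer level, so they cannot lie
  strictly between the end points of the finer one, which are consecutive vertices of its level.
\<close>

lemma edges_noncrossing:
  assumes tu: "edge t u" and pq: "edge p q" and cross: "t < p" "p < u" "u < q" "q < t + 2"
  shows False
proof -
  have dyadic: "\<exists>c d :: int. t = of_int c / 2 ^ n \<and> u = of_int d / 2 ^ n"
    if "(t = (of_int m - 1) / 2 ^ n \<and> u = of_int m / 2 ^ n) \<or> (t = of_int m / 2 ^ n \<and> u = (of_int m - 1) / 2 ^ n + 2)"
    for m :: int and n :: nat and t u :: real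
    using that
  proof
    assume "t = (of_int m - 1) / 2 ^ n \<and> u = of_int m / 2 ^ n"
    then show ?thesis by (intro exI[of _ "m - 1"] exI[of _ m]) simp
  next
    assume "t = of_int m / 2 ^ n \<and> u = (of_int m - 1) / 2 ^ n + 2"
    then show ?thesis by (intro exI[of _ m] exI[of _ "m - 1 + 2 * 2 ^ n"]) (simp add: field_simps)
  qed
  have shift: "\<exists>d::int. (of_int c :: real) / 2 ^ n - 2 = of_int d / 2 ^ n" for c :: int and n :: nat
    by (intro exI[of _ "c - 2 * 2 ^ n"]) (simp add: field_simps)
  obtain m n where tu': "(t = (of_int m - 1) / 2 ^ n \<and> u = of_int m / 2 ^ n) \<or>
     (t = of_int m / 2 ^ n \<and> u = (of_int m - 1) / 2 ^ n + 2)" using tu by (auto simp: edge_def)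
  obtain m' n' where pq': "(p = (of_int m' - 1) / 2 ^ n' \<and> q = of_int m' / 2 ^ n') \<or>
     (p = of_int m' / 2 ^ n' \<and> q = (of_int m' - 1) / 2 ^ n' + 2)" using pq by (auto simp: edge_def)
  obtain c d :: int where cd: "t = of_int c / 2 ^ n" "u = of_int d / 2 ^ n"
    using dyadic[OF tu'] by blast
  obtain c' d' :: int where cd': "p = of_int c' / 2 ^ n'" "q = of_int d' / 2 ^ n'"
    using dyadic[OF pq'] by blast
  show False
  proof (cases "n \<le> n'")
    case True
    from pq' show False
    proof
      assume "p = (of_int m' - 1) / 2 ^ n' \<and> q = of_int m' / 2 ^ n'"
      then show False using no_dyadic_between[OF True, of m' d] cross by (simp add: cd)
    next
      assume "p = of_int m' / 2 ^ n' \<and> q = (of_int m' - 1) / 2 ^ n' + 2"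
      then show False using no_dyadic_between[OF True, of m' c] cross by (simp add: cd)
    qed
  next
    case False
    then have le: "n' \<le> n" by simp
    from tu' show False
    proof
      assume "t = (of_int m - 1) / 2 ^ n \<and> u = of_int m / 2 ^ n"
      then show False using no_dyadic_between[OF le, of m c'] cross by (simp add: cd')
    next
      assume *: "t = of_int m / 2 ^ n \<and> u = (of_int m - 1) / 2 ^ n + 2"
      obtain e :: int where "q - 2 = of_int e / 2 ^ n'" using shift cd' by metis
      then show False using no_dyadic_between[OF le, of m e] cross * by simp
    qed
  qed
qed


section \<open>Geometry of the strip\<close>

text \<open>
  The action of the \<open>k\<close>-th power of \<open>F\<close> on the plane.
\<close>

definition glide :: "int \<Rightarrow> pt \<Rightarrow> pt" where
  "glide k p = (if even k then (fst p + of_int k * pi, snd p + of_int k * pi)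
     else (snd p + of_int k * pi, fst p + of_int k * pi))"

definition D_rel :: "pt \<Rightarrow> pt \<Rightarrow> bool" where
  "D_rel p q \<longleftrightarrow> pt_le p q \<and> fst q < snd p + pi \<and> snd q < fst p + pi"

definition lifts :: "pt set" where
  "lifts = {glide k p | k p. p \<in> std_cluster}"

definition diag :: "pt \<Rightarrow> real \<Rightarrow> pt" where
  "diag p c = (fst p + c, snd p + c)"

lemma glide_add: "glide k (glide l p) = glide (k + l) p"
  by (auto simp: glide_def algebra_simps)

lemma glide_0 [simp]: "glide 0 p = p"
  by (simp add: glide_def)

lemma glide_le [simp]: "pt_le (glide k p) (glide k q) \<longleftrightarrow> pt_le p q"
  by (auto simp: glide_def pt_le_def)

lemma glide_D_rel [simp]: "D_rel (glide k p) (glide k q) \<longleftrightarrow> D_rel p q"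
  by (auto simp: glide_def pt_le_def D_rel_def)

lemma glide_diag: "glide k (diag p c) = diag (glide k p) c"
  by (auto simp: glide_def diag_def)

lemma pt_le_trans: "pt_le p q \<Longrightarrow> pt_le q r \<Longrightarrow> pt_le p r"
  by (auto simp: pt_le_def)

lemma pt_le_diag: "c \<le> d \<Longrightarrow> pt_le (diag p c) (diag p d)"
  by (simp add: pt_le_def diag_def)

lemma D_rel_between: "D_rel p r \<Longrightarrow> pt_le p q \<Longrightarrow> pt_le q r \<Longrightarrow> D_rel p q \<and> D_rel q r"
  by (auto simp: D_rel_def pt_le_def)

lemma lifts_glide:
  assumes "p \<in> lifts"
  shows "glide k p \<in> lifts"
proof -
  obtain l q where "q \<in> std_cluster" "p = glide l q"
    using assms unfolding lifts_def by blast
  then have "glide k p = glide (k + l) q" "q \<in> std_cluster"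
    by (simp_all add: glide_add)
  then show ?thesis unfolding lifts_def by blast
qed

lemma std_cluster_strip: "p \<in> std_cluster \<Longrightarrow> \<bar>snd p - fst p\<bar> < pi"
proof -
  assume "p \<in> std_cluster"
  then obtain m :: int and n :: nat where p: "p = (of_int m * pi / 2 ^ n, pi + (of_int m - 1) * pi / 2 ^ n)"
    by (auto simp: std_cluster_def)
  have "snd p - fst p = pi - pi / 2 ^ n"
    by (simp add: p field_simps)
  moreover have "0 < pi / 2 ^ n" "pi / 2 ^ n \<le> pi / 1"
    by (simp, intro divide_left_mono) auto
  ultimately show ?thesis by auto
qed

text \<open>
  Reduction of \<open>m\<close> modulo \<open>2 ^ (n + 1)\<close> is a translation by a multiple of \<open>2\<pi>\<close>. The excluded point
  \<open>(\<pi>, \<pi>)\<close> is the image of \<open>(0, 0)\<close> under \<open>F\<close>.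
\<close>

lemma lift_pt: "(of_int m * pi / 2 ^ n, pi + (of_int m - 1) * pi / 2 ^ n) \<in> lifts"
proof -
  define k where "k = m div 2 ^ (n + 1)"
  define r where "r = m mod 2 ^ (n + 1)"
  have r: "0 \<le> r" "r < 2 ^ (n + 1)" by (simp_all add: r_def)
  have "m = k * 2 ^ (n + 1) + r" by (simp only: k_def r_def div_mult_mod_eq)
  then have m: "real_of_int m = of_int k * (2 * 2 ^ n) + of_int r"
    by simp
  let ?p = "(of_int r * pi / 2 ^ n, pi + (of_int r - 1) * pi / 2 ^ n)"
  have eq: "(of_int m * pi / 2 ^ n, pi + (of_int m - 1) * pi / 2 ^ n) = glide (2 * k) ?p"
    by (simp add: glide_def m field_simps)
  show ?thesis
  proof (cases "?p = (pi, pi)")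
    case False
    then have "?p \<in> std_cluster" using r by (auto simp: std_cluster_def)
    then show ?thesis unfolding eq lifts_def by blast
  next
    case True
    have "(0, 0) \<in> std_cluster"
      by (auto simp: std_cluster_def intro!: exI[of _ "0::int"] exI[of _ "0::nat"])
    moreover have "glide (2 * k) ?p = glide (2 * k + 1) (0, 0)"
      unfolding True by (simp add: glide_def algebra_simps)
    ultimately show ?thesis unfolding eq lifts_def by blast
  qed
qed

text \<open>
  Even powers of \<open>F\<close> shift the chord around the circle by multiples of \<open>2\<pi>\<close>; odd powers also exchange
  its end points, which is the other disjunct in the definition of a chord.
\<close>

lemma lifts_iff_edge: "(t, s) \<in> lifts \<longleftrightarrow> edge (t / pi) (s / pi + 1)"
proof
  assume "(t, s) \<in> lifts"
  then obtain k and m :: int and n :: nat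
    where ts: "(t, s) = glide k (of_int m * pi / 2 ^ n, pi + (of_int m - 1) * pi / 2 ^ n)"
    by (auto simp: lifts_def std_cluster_def)
  show "edge (t / pi) (s / pi + 1)"
  proof (cases "even k")
    case True
    let ?m = "m + k * 2 ^ n"
    have "t / pi = of_int ?m / 2 ^ n" "s / pi + 1 = (of_int ?m - 1) / 2 ^ n + 2"
      using ts True by (simp_all add: glide_def field_simps)
    then show ?thesis using edge_complement by metis
  next
    case False
    let ?m = "m + (k + 1) * 2 ^ n"
    have "t / pi = (of_int ?m - 1) / 2 ^ n" "s / pi + 1 = of_int ?m / 2 ^ n"
      using ts False by (simp_all add: glide_def field_simps)
    then show ?thesis using edge_consecutive by metis
  qed
next
  assume "edge (t / pi) (s / pi + 1)"
  then obtain m :: int and n :: nat where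
    "(t / pi = (of_int m - 1) / 2 ^ n \<and> s / pi + 1 = of_int m / 2 ^ n) \<or>
     (t / pi = of_int m / 2 ^ n \<and> s / pi + 1 = (of_int m - 1) / 2 ^ n + 2)"
    by (auto simp: edge_def)
  then show "(t, s) \<in> lifts"
  proof
    assume *: "t / pi = (of_int m - 1) / 2 ^ n \<and> s / pi + 1 = of_int m / 2 ^ n"
    then have "t = pi * ((of_int m - 1) / 2 ^ n)" "s = pi * (of_int m / 2 ^ n - 1)"
      by (auto simp: field_simps)
    then have "(t, s) = glide (-1) (of_int m * pi / 2 ^ n, pi + (of_int m - 1) * pi / 2 ^ n)"
      by (simp add: glide_def field_simps)
    then show ?thesis using lift_pt lifts_glide by metis
  next
    assume "t / pi = of_int m / 2 ^ n \<and> s / pi + 1 = (of_int m - 1) / 2 ^ n + 2"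
    then have "t = pi * (of_int m / 2 ^ n)" "s = pi * ((of_int m - 1) / 2 ^ n + 1)"
      by (auto simp: field_simps)
    then have "(t, s) = (of_int m * pi / 2 ^ n, pi + (of_int m - 1) * pi / 2 ^ n)"
      by (simp add: field_simps)
    then show ?thesis using lift_pt by metis
  qed
qed

text \<open>
  The condition for the basic morphism \<open>p \<rightarrow> r\<close> to be nonzero in \<open>C/T\<close>.
\<close>

definition CT_rel :: "pt \<Rightarrow> pt \<Rightarrow> bool" where
  "CT_rel p r \<longleftrightarrow> D_rel p r \<and> \<not> (\<exists>q \<in> lifts. pt_le p q \<and> pt_le q r)"

lemma glide_CT_rel [simp]: "CT_rel (glide k p) (glide k q) \<longleftrightarrow> CT_rel p q"
proof -
  have "(\<exists>r \<in> lifts. pt_le (glide k p) r \<and> pt_le r (glide k q)) \<longleftrightarrow> (\<exists>r \<in> lifts. pt_le p r \<and> pt_le r q)"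
  proof
    assume "\<exists>r \<in> lifts. pt_le (glide k p) r \<and> pt_le r (glide k q)"
    then obtain r where r: "r \<in> lifts" "pt_le (glide k p) r" "pt_le r (glide k q)" by blast
    have "r = glide k (glide (- k) r)" by (simp add: glide_add)
    then have "pt_le p (glide (- k) r)" "pt_le (glide (- k) r) q"
      using r glide_le by metis+
    then show "\<exists>r \<in> lifts. pt_le p r \<and> pt_le r q" using r lifts_glide by blast
  next
    assume "\<exists>r \<in> lifts. pt_le p r \<and> pt_le r q"
    then show "\<exists>r \<in> lifts. pt_le (glide k p) r \<and> pt_le r (glide k q)"
      using lifts_glide glide_le by metis
  qed
  then show ?thesis by (simp add: CT_rel_def)
qed

lemma CT_rel_between: "CT_rel p r \<Longrightarrow> pt_le p q \<Longrightarrow> pt_le q r \<Longrightarrow> CT_rel p q \<and> CT_rel q r"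
  using D_rel_between pt_le_trans unfolding CT_rel_def by blast

text \<open>
  The separating chord, moved by a small \<open>d > 0\<close>, maps to \<open>w\<close> because its end points precede the arcs.
  A lift in the box between the moved point and \<open>v\<close> would be a chord crossing the separating one.
  This is where the chord has to avoid the arcs strictly: if \<open>s + \<pi>\<close> were equal to \<open>x'\<close>, say, the chords
  starting at \<open>x'\<close> would share an end point with the separating chord, so that they could run to the
  other arc without crossing it.
\<close>

lemma detecting_lift:
  assumes wv: "CT_rel w v"
  obtains q c where "q \<in> lifts" "0 < c" "pt_le (diag q c) w"
    "\<And>d. 0 < d \<Longrightarrow> d \<le> c \<Longrightarrow> CT_rel (diag q d) v"
proof -
  obtain x y x' y' where [simp]: "w = (x, y)" "v = (x', y')" by (cases w, cases v)
  have D: "x \<le> x'" "y \<le> y'" "x' < y + pi" "y' < x + pi"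
    using wv by (auto simp: CT_rel_def D_rel_def pt_le_def)
  have free: False if "(t, s) \<in> lifts" "x \<le> t" "t \<le> x'" "y \<le> s" "s \<le> y'" for t s
    using wv that by (auto simp: CT_rel_def pt_le_def)
  obtain t' u' where e: "edge t' u'" and tu: "y' / pi + 1 - 2 < t'" "t' < x / pi" "x' / pi < u'" "u' < y / pi + 1"
  proof (rule separating_edge[of "x / pi" "x' / pi" "y / pi + 1" "y' / pi + 1"])
    fix t u assume "edge t u" "x / pi \<le> t" "t \<le> x' / pi" "y / pi + 1 \<le> u" "u \<le> y' / pi + 1"
    moreover have "t = (pi * t) / pi" "u = (pi * (u - 1)) / pi + 1" by simp_all
    ultimately show False
      using free[of "pi * t" "pi * (u - 1)"] lifts_iff_edge[of "pi * t" "pi * (u - 1)"]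
      by (simp add: field_simps)
  next
    have "x' / pi < (y + pi) / pi" "y' / pi < (x + pi) / pi"
      using D by (simp_all add: divide_strict_right_mono)
    then show "x' / pi < y / pi + 1" "y' / pi + 1 < x / pi + 2"
      by (simp_all add: add_divide_distrib)
  qed (use D in \<open>auto simp: divide_right_mono\<close>)
  \<comment> \<open>Back from chords with circumference 2 to points of the plane.\<close>
  define t s where "t = pi * t'" and "s = pi * (u' - 1)"
  have lift: "(t, s) \<in> lifts"
    using e by (simp add: lifts_iff_edge t_def s_def)
  have ts: "y' - pi < t" "t < x" "x' - pi < s" "s < y"
    using tu by (auto simp: t_def s_def field_simps)
  define c where "c = min (x - t) (y - s)"
  show thesis
  proof (rule that[OF lift])
    show "0 < c" "pt_le (diag (t, s) c) w"
      using ts by (auto simp: c_def diag_def pt_le_def)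
    fix d assume d: "0 < d" "d \<le> c"
    have "False" if "(p, r) \<in> lifts" "t + d \<le> p" "p \<le> x'" "s + d \<le> r" "r \<le> y'" for p r
    proof (rule edges_noncrossing)
      show "edge (t / pi) (s / pi + 1)" "edge (p / pi) (r / pi + 1)"
        using lift that(1) by (simp_all add: lifts_iff_edge)
      have "t / pi < p / pi" "p / pi < (s + pi) / pi" "s / pi < r / pi" "r / pi < (t + pi) / pi"
        using that d ts by (simp_all add: divide_strict_right_mono)
      then show "t / pi < p / pi" "p / pi < s / pi + 1" "s / pi + 1 < r / pi + 1" "r / pi + 1 < t / pi + 2"
        by (simp_all add: add_divide_distrib)
    qed
    then show "CT_rel (diag (t, s) d) v"
      using d ts D by (auto simp: CT_rel_def D_rel_def diag_def pt_le_def c_def)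
  qed
qed


section \<open>The category C/T has a multiplicative basis\<close>

subsection \<open>From B to D\<close>

definition B_rel :: "int \<Rightarrow> pt \<Rightarrow> pt \<Rightarrow> bool" where
  "B_rel n p q \<longleftrightarrow> n = 0 \<and> pt_le p q"

definition mat_co :: "pt list \<Rightarrow> pt list \<Rightarrow> 'k::field mat \<Rightarrow> 'k coeffs" where
  "mat_co X Y A = (\<lambda>(n, i, j). if n = 0 \<and> i < length Y \<and> j < length X then A $$ (i, j) else 0)"

lemma B_carrier: "A \<in> carrier (Hom cat_B X Y) \<longleftrightarrow> A \<in> carrier_mat (length Y) (length X) \<and>
    (\<forall>i < length Y. \<forall>j < length X. \<not> pt_le (X ! j) (Y ! i) \<longrightarrow> A $$ (i, j) = 0)"
  by (simp add: cat_B_def)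

lemma based_cat_B: "based_cat B_rel (cat_B :: (pt list, 'k::field mat) precat) mat_co"
proof unfold_locales
  fix k l m a b c d
  assume "B_rel k a b" "B_rel l b c" "B_rel m c d" "B_rel (k + l + m) a d"
  then show "B_rel (k + l) a c \<and> B_rel (l + m) b d"
    by (auto simp: B_rel_def pt_le_def)
next
  fix k a b assume "B_rel k a b"
  then show "B_rel 0 a a \<and> B_rel 0 b b"
    by (simp add: B_rel_def pt_le_def)
next
  fix X Y :: "pt list"
  show "bij_betw (mat_co X Y :: 'k mat \<Rightarrow> 'k coeffs) (carrier (Hom cat_B X Y))
      {e. finite (supp e) \<and> supp e \<subseteq> pos B_rel X Y}"
    unfolding bij_betw_def
  proof (intro conjI equalityI subsetI)
    show "inj_on (mat_co X Y :: 'k mat \<Rightarrow> _) (carrier (Hom cat_B X Y))"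
    proof (rule inj_onI)
      fix A B :: "'k mat"
      assume AB: "A \<in> carrier (Hom cat_B X Y)" "B \<in> carrier (Hom cat_B X Y)" "mat_co X Y A = mat_co X Y B"
      have "A $$ (i, j) = B $$ (i, j)" if "i < length Y" "j < length X" for i j
        using fun_cong[OF AB(3), of "(0, i, j)"] that by (simp add: mat_co_def)
      then show "A = B"
        using AB(1,2) by (intro eq_matI) (auto simp: B_carrier)
    qed
    fix e :: "'k coeffs"
    show "e \<in> {e. finite (supp e) \<and> supp e \<subseteq> pos B_rel X Y}"
      if "e \<in> mat_co X Y ` carrier (Hom cat_B X Y)"
    proof -
      obtain A where A: "A \<in> carrier (Hom cat_B X Y)" "e = mat_co X Y A" using \<open>e \<in> _\<close> by blast
      have "supp e \<subseteq> {0} \<times> {..<length Y} \<times> {..<length X}"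
        by (auto simp: A supp_def mat_co_def split: if_splits)
      then have "finite (supp e)" by (rule finite_subset) simp
      moreover have "pt_le (X ! j) (Y ! i)" if "i < length Y" "j < length X" "A $$ (i, j) \<noteq> 0" for i j
        using A(1) that by (auto simp: B_carrier)
      then have "supp e \<subseteq> pos B_rel X Y"
        by (auto simp: A(2) supp_def mat_co_def pos_def B_rel_def split: if_splits)
      ultimately show ?thesis by simp
    qed
    assume "e \<in> {e. finite (supp e) \<and> supp e \<subseteq> pos B_rel X Y}"
    then have e: "supp e \<subseteq> pos B_rel X Y" by simp
    then have zero: "e (n, i, j) = 0" if "\<not> (n = 0 \<and> i < length Y \<and> j < length X \<and> pt_le (X ! j) (Y ! i))" for n i j
      using that by (auto simp: supp_def pos_def B_rel_def)
    define A where "A = mat (length Y) (length X) (\<lambda>(i, j). e (0, i, j))"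
    have "A \<in> carrier (Hom cat_B X Y)"
      using zero by (auto simp: B_carrier A_def)
    moreover have "mat_co X Y A = e"
      using zero by (auto simp: mat_co_def A_def fun_eq_iff)
    ultimately show "e \<in> mat_co X Y ` carrier (Hom cat_B X Y)" by blast
  qed
next
  fix X Y Z :: "pt list" and f g :: "'k mat"
  assume f: "f \<in> carrier (Hom cat_B X Y)" and g: "g \<in> carrier (Hom cat_B Y Z)"
  have dim: "dim_row f = length Y" "dim_col f = length X" "dim_row g = length Z" "dim_col g = length Y"
    using f g by (auto simp: B_carrier)
  have entry: "(g * f) $$ (i, j) = (\<Sum>l < length Y. g $$ (i, l) * f $$ (l, j))" if "i < length Z" "j < length X" for i j
    using that dim by (simp add: scalar_prod_def lessThan_atLeast0)
  have "(g * f) $$ (i, j) = 0" if "i < length Z" "j < length X" "\<not> pt_le (X ! j) (Z ! i)" for i j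
  proof -
    have "g $$ (i, l) * f $$ (l, j) = 0" if "l < length Y" for l
      using f g that \<open>i < length Z\<close> \<open>j < length X\<close> \<open>\<not> pt_le _ _\<close> pt_le_trans[of "X ! j" "Y ! l" "Z ! i"]
      by (auto simp: B_carrier)
    then have "(\<Sum>l < length Y. g $$ (i, l) * f $$ (l, j)) = 0"
      by (intro sum.neutral) simp
    then show ?thesis using that by (simp only: entry)
  qed
  note outside = this
  then show "Cmp cat_B X Y Z g f \<in> carrier (Hom cat_B X Z)"
    using dim outside by (auto simp: B_carrier cat_B_def)
  have "mat_co X Z (g * f) (n, i, j) = truncate (pos B_rel X Z) (conv (mat_co Y Z g) (mat_co X Y f)) (n, i, j)" for n i j
  proof (cases "(n, i, j) \<in> pos B_rel X Z")
    case True
    then have [simp]: "n = 0" and ij: "i < length Z" "j < length X" by (auto simp: pos_def B_rel_def)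
    have "supp (mat_co X Y f) \<subseteq> {0} \<times> {..<length Y} \<times> {..<length X}"
      by (auto simp: supp_def mat_co_def split: if_splits)
    then have "finite (supp (mat_co X Y f))" by (rule finite_subset) simp
    then have "conv (mat_co Y Z g) (mat_co X Y f) (n, i, j) =
        (\<Sum>(k, l) \<in> {0} \<times> {..<length Y}. mat_co Y Z g (n - k, i, l) * mat_co X Y f (k, l, j))"
      by (intro conv_eq_sum) (auto simp: mat_co_def split: if_splits)
    also have "\<dots> = (g * f) $$ (i, j)"
      using ij by (simp add: entry sum.cartesian_product[symmetric] mat_co_def)
    finally show ?thesis using True ij by (simp add: truncate_def mat_co_def)
  next
    case False
    then show ?thesis
      using outside by (auto simp: truncate_def mat_co_def pos_def B_rel_def)
  qed
  then show "mat_co X Z (Cmp cat_B X Y Z g f) = truncate (pos B_rel X Z) (conv (mat_co Y Z g) (mat_co X Y f))"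
    by (auto simp: cat_B_def)
qed (auto simp: cat_B_def mat_co_def truncate_def pos_def B_rel_def pt_le_def fun_eq_iff)

definition wide :: "pt set" where
  "wide = {p. pi \<le> \<bar>snd p - fst p\<bar>}"

text \<open>
  If the box between \<open>p\<close> and \<open>q\<close> meets the region \<open>|y - x| \<ge> \<pi>\<close>, then so does one of its corners
  \<open>(x', y)\<close> and \<open>(x, y')\<close>, at which \<open>y - x\<close> is extremal.
\<close>

lemma avoiding_wide: "avoiding B_rel wide n p q \<longleftrightarrow> n = 0 \<and> D_rel p q"
proof -
  have "D_rel p q \<longleftrightarrow> pt_le p q \<and> \<not> (\<exists>r \<in> wide. pt_le p r \<and> pt_le r q)"
  proof (intro iffI conjI notI)
    assume "D_rel p q" "\<exists>r \<in> wide. pt_le p r \<and> pt_le r q"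
    then show False by (auto simp: D_rel_def pt_le_def wide_def abs_if split: if_splits)
  next
    assume *: "pt_le p q \<and> \<not> (\<exists>r \<in> wide. pt_le p r \<and> pt_le r q)"
    then have "pt_le p (fst q, snd p)" "pt_le (fst q, snd p) q" "pt_le p (fst p, snd q)" "pt_le (fst p, snd q) q"
      by (auto simp: pt_le_def)
    then have "(fst q, snd p) \<notin> wide" "(fst p, snd q) \<notin> wide" using * by blast+
    then show "D_rel p q" using * by (auto simp: D_rel_def wide_def)
  qed (simp add: D_rel_def)
  then show ?thesis
    by (auto simp: avoiding_def B_rel_def)
qed

interpretation B: based_cat B_rel "cat_B :: (pt list, 'k::field mat) precat" mat_co
  by (rule based_cat_B)

lemma B_pi_eq: "B_pi = {Z. set Z \<subseteq> wide}"
  by (auto simp: B_pi_def wide_def)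

definition D_co :: "pt list \<Rightarrow> pt list \<Rightarrow> 'k::field mat set \<Rightarrow> 'k coeffs" where
  "D_co = B.quot_co wide"

lemma thru_B_pi: "thru cat_B B_pi X Y = thru cat_B {Z. set Z \<subseteq> wide} X Y"
  by (simp add: B_pi_eq)

lemma avoiding_wide': "avoiding B_rel wide = (\<lambda>n p q. n = 0 \<and> D_rel p q)"
  by (simp add: avoiding_wide fun_eq_iff)

lemma based_cat_D: "based_cat (\<lambda>n p q. n = 0 \<and> D_rel p q) (cat_D :: (pt list, 'k::field mat set) precat) D_co"
  using based_cat.based_cat_full_subcat[OF B.based_cat_quot[OF thru_B_pi]]
  unfolding cat_D_def D_co_def avoiding_wide' .

lemma D2_Hom: "Hom cat_D2 X Y = Hom (quot_cat cat_B B_pi) (map fst X) (map fst Y)"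
  by (simp add: cat_D2_def doubled_def cat_D_def full_subcat_def)

definition D2_co :: "pt2 list \<Rightarrow> pt2 list \<Rightarrow> 'k::field mat set \<Rightarrow> 'k coeffs" where
  "D2_co X Y = D_co (map fst X) (map fst Y)"

lemma based_cat_D2:
  "based_cat (\<lambda>n a b. n = 0 \<and> D_rel (fst a) (fst b)) (cat_D2 :: (pt2 list, 'k::field mat set) precat) D2_co"
  using based_cat.based_cat_doubled[OF based_cat_D] unfolding cat_D2_def D2_co_def[abs_def] .

subsection \<open>The orbit category\<close>

definition move :: "int \<Rightarrow> pt2 \<Rightarrow> pt2" where
  "move k a = (glide k (fst a), snd a \<noteq> odd k)"

lemma move_add: "move k (move l a) = move (k + l) a"
  by (auto simp: move_def glide_add)

lemma move_0: "move 0 a = a"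
  by (simp add: move_def)

lemma fst_move [simp]: "fst (move k a) = glide k (fst a)"
  by (simp add: move_def)

lemma F_ob_eq: "F_ob k = map (move k)"
proof -
  have F: "F_ind = move 1"
    by (auto simp: F_ind_def move_def glide_def)
  have inv: "inv_into UNIV F_ind = move (-1)"
    unfolding F by (rule inv_equality) (simp_all add: move_add move_0)
  have pow: "move l ^^ n = move (int n * l)" for l n
    by (induction n) (auto simp: move_0 move_add algebra_simps)
  show ?thesis
    by (auto simp: F_ob_def F inv[unfolded F] pow)
qed

text \<open>
  \<open>F\<close> preserves the order of the plane and the region \<open>|y - x| < \<pi>\<close>, so the same matrix represents a
  morphism and its translate, and the choice of the representing matrix does not matter.
\<close>

lemma F_mor_quot_mor:
  fixes A :: "'k::field mat"
  assumes A: "A \<in> carrier (Hom cat_B (map fst X) (map fst Y))"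
  shows "A \<in> carrier (Hom cat_B (map fst (F_ob k X)) (map fst (F_ob k Y)))"
    and "F_mor k X Y (quot_mor cat_B B_pi (map fst X) (map fst Y) A) =
      quot_mor cat_B B_pi (map fst (F_ob k X)) (map fst (F_ob k Y)) A"
proof -
  let ?X = "map fst X" and ?Y = "map fst Y" and ?X' = "map fst (F_ob k X)" and ?Y' = "map fst (F_ob k Y)"
  have closed: "A' \<in> carrier (Hom cat_B ?X' ?Y')" if "A' \<in> carrier (Hom cat_B ?X ?Y)" for A' :: "'k mat"
    using that by (auto simp: B_carrier F_ob_eq)
  then show "A \<in> carrier (Hom cat_B ?X' ?Y')" using A .
  have pos: "pos (avoiding B_rel wide) ?X' ?Y' = pos (avoiding B_rel wide) ?X ?Y"
    by (auto simp: pos_def avoiding_wide F_ob_eq)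
  have co: "mat_co ?X' ?Y' A' = mat_co ?X ?Y A'" for A' :: "'k mat"
    by (simp add: mat_co_def F_ob_eq)
  have "quot_mor cat_B B_pi ?X' ?Y' A' = quot_mor cat_B B_pi ?X' ?Y' A"
    if "A' \<in> quot_mor cat_B B_pi ?X ?Y A" for A'
  proof -
    have A': "A' \<in> carrier (Hom cat_B ?X ?Y)" "quot_mor cat_B B_pi ?X ?Y A' = quot_mor cat_B B_pi ?X ?Y A"
      using that B.mem_quot_mor[OF thru_B_pi A] by auto
    then show ?thesis
      using A by (simp add: B.quot_mor_eq_iff[OF thru_B_pi] closed pos co)
  qed
  moreover have "A \<in> quot_mor cat_B B_pi ?X ?Y A"
    using B.mem_quot_mor[OF thru_B_pi A] A by simp
  ultimately show "F_mor k X Y (quot_mor cat_B B_pi ?X ?Y A) = quot_mor cat_B B_pi ?X' ?Y' A"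
    unfolding F_mor_def by blast
qed

lemma orbit_action_D2:
  "orbit_action (\<lambda>n a b. n = 0 \<and> D_rel (fst a) (fst b)) (cat_D2 :: (pt2 list, 'k::field mat set) precat) D2_co move F_mor"
proof (intro orbit_action.intro orbit_action_axioms.intro based_cat_D2)
  fix k X Y and f :: "'k mat set"
  assume "f \<in> carrier (Hom cat_D2 X Y)"
  then obtain A where A: "A \<in> carrier (Hom cat_B (map fst X) (map fst Y))"
    "f = quot_mor cat_B B_pi (map fst X) (map fst Y) A"
    unfolding D2_Hom by (rule B.quot_carrierE[OF thru_B_pi])
  note F = F_mor_quot_mor[OF A(1), of k]
  show "F_mor k X Y f \<in> carrier (Hom cat_D2 (map (move k) X) (map (move k) Y))"
    using B.quot_mor_closed[OF thru_B_pi F(1)] by (simp only: D2_Hom A(2) F(2) flip: F_ob_eq)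
  have "pos (avoiding B_rel wide) (map fst (F_ob k X)) (map fst (F_ob k Y)) = pos (avoiding B_rel wide) (map fst X) (map fst Y)"
    by (auto simp: pos_def avoiding_wide F_ob_eq)
  moreover have "mat_co (map fst (F_ob k X)) (map fst (F_ob k Y)) A = mat_co (map fst X) (map fst Y) A"
    by (simp add: mat_co_def F_ob_eq)
  ultimately show "D2_co (map (move k) X) (map (move k) Y) (F_mor k X Y f) = D2_co X Y f"
    by (simp only: D2_co_def D_co_def A(2) F(2) B.quot_co_quot_mor[OF thru_B_pi F(1)]
        B.quot_co_quot_mor[OF thru_B_pi A(1)] flip: F_ob_eq)
qed (simp_all add: move_add move_0)

interpretation D2: orbit_action "\<lambda>n a b. n = 0 \<and> D_rel (fst a) (fst b)"
    "cat_D2 :: (pt2 list, 'k::field mat set) precat" D2_co move F_mor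
  by (rule orbit_action_D2)

definition C_rel :: "int \<Rightarrow> pt2 \<Rightarrow> pt2 \<Rightarrow> bool" where
  "C_rel n a b \<longleftrightarrow> D_rel (fst a) (glide n (fst b))"

definition C_co :: "pt2 list \<Rightarrow> pt2 list \<Rightarrow> (int \<Rightarrow> 'k::field mat set) \<Rightarrow> 'k coeffs" where
  "C_co = D2.orbit_co"

lemma F_ob_eq': "F_ob = (\<lambda>k. map (move k))"
  by (simp add: F_ob_eq fun_eq_iff)

lemma cat_C_eq: "cat_C = orbit_cat cat_D2 (\<lambda>k. map (move k)) F_mor"
  by (simp add: cat_C_def F_ob_eq')

lemma orbit_rel_eq: "D2.orbit_rel = C_rel"
  by (simp add: fun_eq_iff D2.orbit_rel_def C_rel_def)

lemma based_cat_C: "based_cat C_rel (cat_C :: (pt2 list, int \<Rightarrow> 'k::field mat set) precat) C_co"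
  using D2.based_cat_orbit unfolding orbit_rel_eq C_co_def cat_C_eq .

interpretation C: based_cat C_rel "cat_C :: (pt2 list, int \<Rightarrow> 'k::field mat set) precat" C_co
  by (rule based_cat_C)

subsection \<open>The quotient by the standard cluster\<close>

definition T_objects :: "pt2 set" where
  "T_objects = (\<lambda>p. (p, False)) ` std_cluster"

lemma concat_M: "concat (map M ps) = map (\<lambda>p. (p, False)) ps"
  by (induction ps) (auto simp: M_def)

lemma Obj_C: "X \<in> Obj cat_C \<longleftrightarrow> (\<forall>a \<in> set X. \<bar>snd (fst a) - fst (fst a)\<bar> < pi)"
  by (auto simp: cat_C_def orbit_cat_def cat_D2_def doubled_def cat_D_def full_subcat_def quot_cat_def cat_B_def)

text \<open>
  An isomorphism from an object of \<open>add T\<close> to a direct sum of objects of the cluster carries any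
  factorization over.
\<close>

lemma thru_add_T:
  "thru (cat_C :: (pt2 list, int \<Rightarrow> 'k::field mat set) precat) (add_T TYPE('k)) X Y =
    thru cat_C {Z. set Z \<subseteq> T_objects} X Y"
proof (intro equalityI subsetI)
  fix f :: "int \<Rightarrow> 'k mat set"
  assume "f \<in> thru cat_C {Z. set Z \<subseteq> T_objects} X Y"
  moreover have "Z \<in> add_T TYPE('k)" if Z: "set Z \<subseteq> T_objects" for Z
  proof -
    have "map (\<lambda>p. (p, False)) (map fst Z) = Z"
      using Z by (induction Z) (auto simp: T_objects_def)
    then have "concat (map M (map fst Z)) = Z"
      by (simp only: concat_M)
    moreover have "set (map fst Z) \<subseteq> std_cluster"
      using Z by (auto simp: T_objects_def)
    moreover have "isomorphic (cat_C :: (pt2 list, int \<Rightarrow> 'k mat set) precat) Z Z"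
      unfolding isomorphic_def using C.Idn_closed C.Idn_left by blast
    moreover have "Z \<in> Obj (cat_C :: (pt2 list, int \<Rightarrow> 'k mat set) precat)"
      unfolding Obj_C using Z std_cluster_strip by (auto simp: T_objects_def)
    ultimately show ?thesis
      unfolding add_T_def by (intro CollectI conjI exI[of _ "map fst Z"]) simp_all
  qed
  ultimately show "f \<in> thru cat_C (add_T TYPE('k)) X Y"
    unfolding thru_def by blast
next
  fix f :: "int \<Rightarrow> 'k mat set"
  assume "f \<in> thru cat_C (add_T TYPE('k)) X Y"
  then obtain Z g h where f: "f \<in> carrier (Hom cat_C X Y)" and Z: "Z \<in> add_T TYPE('k)"
    and g: "g \<in> carrier (Hom cat_C X Z)" and h: "h \<in> carrier (Hom cat_C Z Y)" and eq: "f = Cmp cat_C X Z Y h g"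
    by (auto simp: thru_def)
  obtain ps where ps: "set ps \<subseteq> std_cluster"
    "isomorphic (cat_C :: (pt2 list, int \<Rightarrow> 'k mat set) precat) Z (concat (map M ps))"
    using Z by (auto simp: add_T_def)
  define Z' where "Z' = concat (map M ps)"
  obtain a b :: "int \<Rightarrow> 'k mat set" where a: "a \<in> carrier (Hom cat_C Z Z')" and b: "b \<in> carrier (Hom cat_C Z' Z)"
    and ba: "Cmp cat_C Z Z' Z b a = Idn cat_C Z"
    using ps(2) by (auto simp: isomorphic_def Z'_def)
  have "f = Cmp cat_C X Z' Y (Cmp cat_C Z' Z Y h b) (Cmp cat_C X Z Z' a g)"
    using eq C.Idn_left[OF g] C.Cmp_assoc[OF g a b] C.Cmp_assoc[OF C.Cmp_closed[OF g a] b h] ba by simp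
  moreover have "set Z' \<subseteq> T_objects"
    using ps(1) by (auto simp: Z'_def concat_M T_objects_def)
  ultimately show "f \<in> thru cat_C {Z. set Z \<subseteq> T_objects} X Y"
    using f C.Cmp_closed[OF g a] C.Cmp_closed[OF b h] unfolding thru_def by blast
qed

text \<open>
  \<open>F\<close> preserves the relation \<open>D_rel\<close>, so that two basic morphisms \<open>a \<rightarrow> c \<rightarrow> b\<close> in \<open>C\<close> with an object \<open>c\<close>
  of the cluster become two consecutive basic morphisms in the plane through a lift of \<open>c\<close>. Inside the
  box of a nonzero basic morphism all basic morphisms are nonzero, which leaves the condition that the
  lift lies in the box.
\<close>

lemma avoiding_T: "avoiding C_rel T_objects n a b \<longleftrightarrow> CT_rel (fst a) (glide n (fst b))"
proof -
  have "(\<exists>c \<in> T_objects. \<exists>k. C_rel k a c \<and> C_rel (n - k) c b) \<longleftrightarrow>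
      (\<exists>q \<in> lifts. pt_le (fst a) q \<and> pt_le q (glide n (fst b)))" if ab: "D_rel (fst a) (glide n (fst b))"
  proof -
    have "C_rel k a c \<and> C_rel (n - k) c b \<longleftrightarrow>
        pt_le (fst a) (glide k (fst c)) \<and> pt_le (glide k (fst c)) (glide n (fst b))" for k c
    proof -
      have "C_rel (n - k) c b \<longleftrightarrow> D_rel (glide k (fst c)) (glide n (fst b))"
        using glide_D_rel[of k "fst c" "glide (n - k) (fst b)"] by (simp add: C_rel_def glide_add)
      then show ?thesis
        using D_rel_between[OF ab, of "glide k (fst c)"] by (auto simp: C_rel_def D_rel_def)
    qed
    then have "(\<exists>c \<in> T_objects. \<exists>k. C_rel k a c \<and> C_rel (n - k) c b) \<longleftrightarrow>
        (\<exists>p \<in> std_cluster. \<exists>k. pt_le (fst a) (glide k p) \<and> pt_le (glide k p) (glide n (fst b)))"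
      by (simp add: T_objects_def)
    also have "\<dots> \<longleftrightarrow> (\<exists>q \<in> lifts. pt_le (fst a) q \<and> pt_le q (glide n (fst b)))"
      unfolding lifts_def by blast
    finally show ?thesis .
  qed
  then show ?thesis
    by (auto simp: avoiding_def CT_rel_def C_rel_def)
qed

definition CT_co :: "pt2 list \<Rightarrow> pt2 list \<Rightarrow> 'k::field ct_mor \<Rightarrow> 'k coeffs" where
  "CT_co = C.quot_co T_objects"

lemma based_cat_CT:
  "based_cat (\<lambda>n a b. CT_rel (fst a) (glide n (fst b))) (cat_CT :: (pt2 list, 'k::field ct_mor) precat) CT_co"
proof -
  have "avoiding C_rel T_objects = (\<lambda>n a b. CT_rel (fst a) (glide n (fst b)))"
    by (simp add: fun_eq_iff avoiding_T)
  then show ?thesis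
    using C.based_cat_quot[OF thru_add_T] by (simp add: cat_CT_def CT_co_def)
qed

interpretation CT: based_cat "\<lambda>n a b. CT_rel (fst a) (glide n (fst b))" "cat_CT :: (pt2 list, 'k::field ct_mor) precat" CT_co
  by (rule based_cat_CT)

lemma S_basic_coefficients:
  assumes "e \<le> d"
  shows "(S_basic p e d :: 'k::field ct_mor) \<in> carrier (Hom cat_CT (S_eps p e) (S_eps p d))"
    and "CT_co (S_eps p e) (S_eps p d) (S_basic p e d :: 'k ct_mor) =
      truncate (pos (\<lambda>n a b. CT_rel (fst a) (glide n (fst b))) (S_eps p e) (S_eps p d)) (\<lambda>t. if t = (0, 0, 0) then 1 else 0)"
proof -
  let ?X = "S_eps p e" and ?Y = "S_eps p d"
  let ?X' = "map fst ?X" and ?Y' = "map fst ?Y"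
  define A where "A = (1\<^sub>m 1 :: 'k mat)"
  define B where "B = quot_mor cat_B B_pi ?X' ?Y' A"
  define G where "G = orbit_mor cat_D2 F_ob ?X ?Y B"
  have S: "S_basic p e d = quot_mor cat_C (add_T TYPE('k)) ?X ?Y G"
    by (simp add: S_basic_def G_def B_def A_def)
  have A: "A \<in> carrier (Hom cat_B ?X' ?Y')" "mat_co ?X' ?Y' A = (\<lambda>t. if t = (0, 0, 0) then 1 else 0)"
    using assms by (auto simp: B_carrier A_def S_eps_def M_def pt_le_def mat_co_def fun_eq_iff)
  have B: "B \<in> carrier (Hom cat_D2 ?X ?Y)"
    "D2_co ?X ?Y B = truncate (pos (avoiding B_rel wide) ?X' ?Y') (\<lambda>t. if t = (0, 0, 0) then 1 else 0)"
    using B.quot_mor_closed[OF thru_B_pi A(1)] B.quot_co_quot_mor[OF thru_B_pi A(1)]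
    by (simp_all add: B_def D2_Hom D2_co_def D_co_def A(2))
  have G: "G \<in> carrier (Hom cat_C ?X ?Y)" "C_co ?X ?Y G = D2_co ?X ?Y B"
    using D2.orbit_mor_closed[OF B(1)] D2.orbit_co_orbit_mor[OF B(1)]
    by (simp_all add: G_def F_ob_eq' cat_C_eq C_co_def)
  have pos: "pos (avoiding C_rel T_objects) ?X ?Y = pos (\<lambda>n a b. CT_rel (fst a) (glide n (fst b))) ?X ?Y"
    by (simp add: pos_def avoiding_T)
  show "S_basic p e d \<in> carrier (Hom (cat_CT :: (pt2 list, 'k ct_mor) precat) ?X ?Y)"
    using C.quot_mor_closed[OF thru_add_T G(1)] by (simp add: S cat_CT_def)
  have "CT_co ?X ?Y (S_basic p e d :: 'k ct_mor) = truncate (pos (avoiding C_rel T_objects) ?X ?Y) (D2_co ?X ?Y B)"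
    using C.quot_co_quot_mor[OF thru_add_T G(1)] by (simp add: S CT_co_def G(2))
  also have "\<dots> = truncate (pos (avoiding C_rel T_objects) ?X ?Y) (\<lambda>t. if t = (0, 0, 0) then 1 else 0 :: 'k)"
    unfolding B(2) by (auto simp: truncate_def fun_eq_iff pos_def avoiding_wide avoiding_T CT_rel_def)
  finally show "CT_co ?X ?Y (S_basic p e d :: 'k ct_mor) =
      truncate (pos (\<lambda>n a b. CT_rel (fst a) (glide n (fst b))) ?X ?Y) (\<lambda>t. if t = (0, 0, 0) then 1 else 0 :: 'k)"
    by (simp only: pos)
qed


section \<open>Germs\<close>

abbreviation CT_pos :: "pt2 list \<Rightarrow> pt2 list \<Rightarrow> (int \<times> nat \<times> nat) set" where
  "CT_pos \<equiv> pos (\<lambda>n a b. CT_rel (fst a) (glide n (fst b)))"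

definition restr :: "pt \<Rightarrow> pt2 list \<Rightarrow> real \<Rightarrow> real \<Rightarrow> 'k::field ct_mor \<Rightarrow> 'k ct_mor" where
  "restr p X c e g = Cmp cat_CT (S_eps p c) (S_eps p e) X g (S_basic p c e)"

lemma S_eps_diag: "S_eps p e = [(diag p e, False)]"
  by (simp add: S_eps_def M_def diag_def)

lemma restr_closed:
  "c \<le> e \<Longrightarrow> g \<in> carrier (Hom cat_CT (S_eps p e) X) \<Longrightarrow> restr p X c e g \<in> carrier (Hom cat_CT (S_eps p c) X)"
  unfolding restr_def by (intro CT.Cmp_closed S_basic_coefficients(1))

text \<open>
  The source of the restriction has a single summand, so restriction keeps each coefficient whose
  basic morphism is still nonzero and drops the others.
\<close>

lemma CT_co_restr:
  assumes "c \<le> e" and g: "g \<in> carrier (Hom cat_CT (S_eps p e) X)"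
  shows "CT_co (S_eps p c) X (restr p X c e g) = truncate (CT_pos (S_eps p c) X) (CT_co (S_eps p e) X g)"
proof -
  let ?\<beta> = "S_basic p c e :: 'a ct_mor"
  note b = S_basic_coefficients[OF assms(1), of p, where 'k = 'a]
  have "conv (CT_co (S_eps p e) X g) (CT_co (S_eps p c) (S_eps p e) ?\<beta>) (n, i, j) = CT_co (S_eps p e) X g (n, i, j)"
    if pos: "(n, i, j) \<in> CT_pos (S_eps p c) X" for n i j
  proof -
    have [simp]: "j = 0" using pos by (simp add: pos_iff S_eps_diag)
    have "conv (CT_co (S_eps p e) X g) (CT_co (S_eps p c) (S_eps p e) ?\<beta>) (n, i, j) =
        (\<Sum>(k, l) \<in> {(0, 0)}. CT_co (S_eps p e) X g (n - k, i, l) * CT_co (S_eps p c) (S_eps p e) ?\<beta> (k, l, j))"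
      by (rule conv_eq_sum[OF _ _ CT.finite_supp_co[OF b(1)]]) (auto simp: b(2) truncate_def split: if_splits)
    also have "\<dots> = CT_co (S_eps p e) X g (n, i, 0)"
    proof (cases "CT_co (S_eps p e) X g (n, i, 0) = 0")
      case False
      then have "(n, i, 0) \<in> CT_pos (S_eps p e) X"
        using CT.co_nonzeroD[OF g] by blast
      then have "pt_le (diag p e) (glide n (fst (X ! i)))" "CT_rel (diag p c) (glide n (fst (X ! i)))"
        using pos by (auto simp: pos_iff S_eps_diag CT_rel_def D_rel_def)
      then have "CT_rel (diag p c) (diag p e)"
        using CT_rel_between pt_le_diag[OF assms(1)] by blast
      then have "(0, 0, 0) \<in> CT_pos (S_eps p c) (S_eps p e)"
        by (simp add: pos_iff S_eps_diag)
      then show ?thesis by (simp add: b(2) truncate_def)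
    qed simp
    finally show ?thesis by simp
  qed
  then show ?thesis
    by (auto simp: restr_def CT.co_Cmp[OF b(1) g] truncate_def fun_eq_iff)
qed

lemma restr_restr:
  assumes "b \<le> c" "c \<le> e" and g: "g \<in> carrier (Hom cat_CT (S_eps p e) X)"
  shows "restr p X b c (restr p X c e g) = restr p X b e g"
proof (rule CT.co_eqD)
  let ?g = "CT_co (S_eps p e) X g"
  have le: "b \<le> e" using assms by simp
  have "truncate (CT_pos (S_eps p b) X) (truncate (CT_pos (S_eps p c) X) ?g) t = truncate (CT_pos (S_eps p b) X) ?g t" for t
  proof -
    obtain n i j where t: "t = (n, i, j)" by (cases t)
    have "(n, i, j) \<in> CT_pos (S_eps p c) X" if "(n, i, j) \<in> CT_pos (S_eps p b) X" "?g (n, i, j) \<noteq> 0"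
    proof -
      have "(n, i, j) \<in> CT_pos (S_eps p e) X" using CT.co_nonzeroD[OF g that(2)] .
      then have "i < length X" "j = 0" "CT_rel (diag p b) (glide n (fst (X ! i)))" "pt_le (diag p e) (glide n (fst (X ! i)))"
        using that(1) by (auto simp: pos_iff S_eps_diag CT_rel_def D_rel_def)
      then show ?thesis
        using CT_rel_between[of "diag p b" "glide n (fst (X ! i))" "diag p c"] assms(1,2)
          pt_le_diag[of b c p] pt_le_trans[OF pt_le_diag[of c e p]] by (simp add: pos_iff S_eps_diag)
    qed
    then show ?thesis by (auto simp: t truncate_def)
  qed
  then show "CT_co (S_eps p b) X (restr p X b c (restr p X c e g)) = CT_co (S_eps p b) X (restr p X b e g)"
    by (simp add: CT_co_restr[OF assms(1) restr_closed[OF assms(2) g]] CT_co_restr[OF assms(2) g] CT_co_restr[OF le g] fun_eq_iff)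
qed (use assms in \<open>auto intro!: restr_closed\<close>)

lemma Cmp_restr:
  assumes "c \<le> e" "g \<in> carrier (Hom cat_CT (S_eps p e) X)" "f \<in> carrier (Hom cat_CT X Y)"
  shows "restr p Y c e (Cmp cat_CT (S_eps p e) X Y f g) = Cmp cat_CT (S_eps p c) X Y f (restr p X c e g)"
  unfolding restr_def using assms by (intro CT.Cmp_assoc S_basic_coefficients(1))

lemma germs_iff: "(e, g) \<in> germs p X \<longleftrightarrow> 0 < e \<and> g \<in> carrier (Hom cat_CT (S_eps p e) X)"
  by (simp add: germs_def)

lemma germ_rel_iff: "((e, g), (d, h)) \<in> germ_rel p X \<longleftrightarrow> (e, g) \<in> germs p X \<and> (d, h) \<in> germs p X \<and>
    (\<exists>c. 0 < c \<and> c \<le> e \<and> c \<le> d \<and> restr p X c e g = restr p X c d h)"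
  by (simp add: germ_rel_def restr_def)

lemma germ_rel_equiv: "equiv (germs p X) (germ_rel p X :: (real \<times> 'k::field ct_mor) rel)"
proof (rule equivI)
  show "(germ_rel p X :: (real \<times> 'k ct_mor) rel) \<subseteq> germs p X \<times> germs p X"
    by (auto simp: germ_rel_def)
  show "refl_on (germs p X) (germ_rel p X :: (real \<times> 'k ct_mor) rel)"
    by (rule refl_onI) (auto simp: germ_rel_iff germs_iff)
  show "sym (germ_rel p X :: (real \<times> 'k ct_mor) rel)"
  proof (rule symI, clarify)
    fix e d and g h :: "'k ct_mor"
    assume "((e, g), (d, h)) \<in> germ_rel p X"
    then show "((d, h), (e, g)) \<in> germ_rel p X"
      unfolding germ_rel_iff by metis
  qed
  show "trans (germ_rel p X :: (real \<times> 'k ct_mor) rel)"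
  proof (rule transI, clarify)
    fix e1 e2 e3 and g1 g2 g3 :: "'k ct_mor"
    assume 12: "((e1, g1), (e2, g2)) \<in> germ_rel p X" and 23: "((e2, g2), (e3, g3)) \<in> germ_rel p X"
    obtain c where c: "0 < c" "c \<le> e1" "c \<le> e2" "restr p X c e1 g1 = restr p X c e2 g2"
      using 12 by (auto simp: germ_rel_iff)
    obtain d where d: "0 < d" "d \<le> e2" "d \<le> e3" "restr p X d e2 g2 = restr p X d e3 g3"
      using 23 by (auto simp: germ_rel_iff)
    have g: "g1 \<in> carrier (Hom cat_CT (S_eps p e1) X)" "g2 \<in> carrier (Hom cat_CT (S_eps p e2) X)" "g3 \<in> carrier (Hom cat_CT (S_eps p e3) X)"
      using 12 23 by (auto simp: germ_rel_iff germs_iff)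
    let ?b = "min c d"
    have "restr p X ?b e1 g1 = restr p X ?b c (restr p X c e1 g1)"
      using c(1-3) g by (simp add: restr_restr)
    also have "\<dots> = restr p X ?b e2 g2"
      using c(1-3) g by (simp only: c(4)) (simp add: restr_restr)
    also have "\<dots> = restr p X ?b d (restr p X d e2 g2)"
      using d(1-3) g by (simp add: restr_restr)
    also have "\<dots> = restr p X ?b e3 g3"
      using d(1-3) g by (simp only: d(4)) (simp add: restr_restr)
    finally show "((e1, g1), (e3, g3)) \<in> germ_rel p X"
      using 12 23 c d unfolding germ_rel_iff by (intro conjI exI[of _ ?b]) auto
  qed
qed

lemma germ_rel_Cmp:
  assumes f: "f \<in> carrier (Hom cat_CT X Y)" and gh: "((e, g), (d, h)) \<in> germ_rel p X"
  shows "((e, Cmp cat_CT (S_eps p e) X Y f g), (d, Cmp cat_CT (S_eps p d) X Y f h)) \<in> germ_rel p Y"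
proof -
  obtain c where c: "0 < c" "c \<le> e" "c \<le> d" "restr p X c e g = restr p X c d h"
    using gh by (auto simp: germ_rel_iff)
  have "g \<in> carrier (Hom cat_CT (S_eps p e) X)" "h \<in> carrier (Hom cat_CT (S_eps p d) X)" "0 < e" "0 < d"
    using gh by (auto simp: germ_rel_iff germs_iff)
  then show ?thesis
    using c f by (auto simp: germ_rel_iff germs_iff CT.Cmp_closed Cmp_restr intro!: exI[of _ c])
qed

lemma tau_Hom_map_class:
  assumes f: "f \<in> carrier (Hom cat_CT X Y)" and g: "(e, g) \<in> germs p X"
  shows "tau_Hom_map p X Y f (germ_rel p X `` {(e, g)}) = germ_rel p Y `` {(e, Cmp cat_CT (S_eps p e) X Y f g)}"
proof -
  have "(\<lambda>(e, g). germ_rel p Y `` {(e, Cmp cat_CT (S_eps p e) X Y f g)}) respects germ_rel p X"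
    by (intro congruentI) (clarify, rule equiv_class_eq[OF germ_rel_equiv], erule germ_rel_Cmp[OF f])
  from UN_equiv_class[OF germ_rel_equiv this g] show ?thesis
    by (simp add: tau_Hom_map_def)
qed

lemma inj_on_tau_Hom_map_iff:
  assumes f: "f \<in> carrier (Hom cat_CT X Y)"
  shows "inj_on (tau_Hom_map p X Y f) (tau_Hom p X) \<longleftrightarrow>
    (\<forall>e g d h. (e, g) \<in> germs p X \<longrightarrow> (d, h) \<in> germs p X \<longrightarrow>
      ((e, Cmp cat_CT (S_eps p e) X Y f g), (d, Cmp cat_CT (S_eps p d) X Y f h)) \<in> germ_rel p Y \<longrightarrow>
      ((e, g), (d, h)) \<in> germ_rel p X)" (is "_ \<longleftrightarrow> ?R")
proof -
  have Cmp_germ: "(e, Cmp cat_CT (S_eps p e) X Y f g) \<in> germs p Y" if "(e, g) \<in> germs p X" for e g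
    using that f by (auto simp: germs_iff CT.Cmp_closed)
  have iff: "tau_Hom_map p X Y f (germ_rel p X `` {(e, g)}) = tau_Hom_map p X Y f (germ_rel p X `` {(d, h)}) \<longleftrightarrow>
      ((e, Cmp cat_CT (S_eps p e) X Y f g), (d, Cmp cat_CT (S_eps p d) X Y f h)) \<in> germ_rel p Y"
    "germ_rel p X `` {(e, g)} = germ_rel p X `` {(d, h)} \<longleftrightarrow> ((e, g), (d, h)) \<in> germ_rel p X"
    if "(e, g) \<in> germs p X" "(d, h) \<in> germs p X" for e g d h
    using that(1,2) Cmp_germ[OF that(1)] Cmp_germ[OF that(2)]
    by (simp_all only: tau_Hom_map_class[OF f] eq_equiv_class_iff[OF germ_rel_equiv])
  show ?thesis
  proof
    assume inj: "inj_on (tau_Hom_map p X Y f) (tau_Hom p X)"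
    have "((e, g), (d, h)) \<in> germ_rel p X"
      if gh: "(e, g) \<in> germs p X" "(d, h) \<in> germs p X"
        and "((e, Cmp cat_CT (S_eps p e) X Y f g), (d, Cmp cat_CT (S_eps p d) X Y f h)) \<in> germ_rel p Y" for e g d h
    proof -
      have "germ_rel p X `` {(e, g)} = germ_rel p X `` {(d, h)}"
        by (rule inj_onD[OF inj]) (use that iff(1)[OF gh] in \<open>simp_all add: tau_Hom_def quotientI\<close>)
      then show ?thesis using iff(2)[OF gh] by simp
    qed
    then show ?R by (intro allI impI)
  next
    assume R: ?R
    show "inj_on (tau_Hom_map p X Y f) (tau_Hom p X)"
    proof (rule inj_onI)
      fix u v assume "u \<in> tau_Hom p X" "v \<in> tau_Hom p X" and eq: "tau_Hom_map p X Y f u = tau_Hom_map p X Y f v"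
      then obtain a b where "a \<in> germs p X" "b \<in> germs p X" "u = germ_rel p X `` {a}" "v = germ_rel p X `` {b}"
        unfolding tau_Hom_def by (elim quotientE)
      then obtain e g d h where gh: "(e, g) \<in> germs p X" "(d, h) \<in> germs p X"
        and uv: "u = germ_rel p X `` {(e, g)}" "v = germ_rel p X `` {(d, h)}"
        by (cases a, cases b) simp
      have "((e, g), (d, h)) \<in> germ_rel p X"
        using eq unfolding uv iff(1)[OF gh] by (intro R[rule_format] gh)
      then show "u = v" using iff(2)[OF gh] uv by simp
    qed
  qed
qed

section \<open>Monomorphisms are detected on germs\<close>

lemma Obj_CT: "X \<in> Obj cat_CT \<longleftrightarrow> (\<forall>a \<in> set X. \<bar>snd (fst a) - fst (fst a)\<bar> < pi)"
  by (simp add: cat_CT_def quot_cat_def Obj_C)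

text \<open>
  Choose a basic morphism \<open>w \<rightarrow> v\<close> in whose coefficient \<open>g\<close> and \<open>h\<close> differ, and let \<open>u\<close> be the basic
  morphism to \<open>w\<close> from the object found in \<open>detecting_lift\<close>. The coefficient in question reappears in
  \<open>g u\<close> and \<open>h u\<close> and survives every restriction.
\<close>

lemma separating_germ:
  fixes g h :: "'k::field ct_mor"
  assumes g: "g \<in> carrier (Hom cat_CT W X)" and h: "h \<in> carrier (Hom cat_CT W X)" and "g \<noteq> h"
  obtains p c u where "p \<in> std_cluster" "0 < c" "u \<in> carrier (Hom cat_CT (S_eps p c) W)"
    "((c, Cmp cat_CT (S_eps p c) W X g u), (c, Cmp cat_CT (S_eps p c) W X h u)) \<notin> germ_rel p X"
proof -
  have "CT_co W X g \<noteq> CT_co W X h"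
    using CT.co_eqD g h \<open>g \<noteq> h\<close> by blast
  then obtain n i j where gh: "CT_co W X g (n, i, j) \<noteq> CT_co W X h (n, i, j)"
    by fastforce
  then have "CT_co W X g (n, i, j) \<noteq> 0 \<or> CT_co W X h (n, i, j) \<noteq> 0" by auto
  then have "(n, i, j) \<in> CT_pos W X"
    using CT.co_nonzeroD g h by blast
  then have i: "i < length X" and j: "j < length W" and rel: "CT_rel (fst (W ! j)) (glide n (fst (X ! i)))"
    by (auto simp: pos_iff)
  obtain q c where "q \<in> lifts" and c: "0 < c" "pt_le (diag q c) (fst (W ! j))"
    and germ: "\<And>d. 0 < d \<Longrightarrow> d \<le> c \<Longrightarrow> CT_rel (diag q d) (glide n (fst (X ! i)))"
    by (rule detecting_lift[OF rel]) blast
  then obtain m p where p: "p \<in> std_cluster" and q: "q = glide m p"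
    by (auto simp: lifts_def)
  have "pt_le (fst (W ! j)) (glide n (fst (X ! i)))"
    using rel by (simp add: CT_rel_def D_rel_def)
  then have qW: "CT_rel (diag q c) (fst (W ! j))"
    using CT_rel_between germ[of c] c by blast
  \<comment> \<open>The lift \<open>q\<close> is \<open>F ^ m\<close> applied to the point \<open>p\<close> of the cluster, hence \<open>u\<close> has degree \<open>- m\<close>.\<close>
  have move_back: "CT_rel (diag p d) (glide (k - m) r) \<longleftrightarrow> CT_rel (diag q d) (glide k r)" for d k r
    using glide_CT_rel[of m "diag p d" "glide (k - m) r"] by (simp add: q glide_add glide_diag)
  let ?S = "S_eps p"
  define e :: "'k coeffs" where "e t = (if t = (- m, j, 0) then 1 else 0)" for t
  have "supp e \<subseteq> {(- m, j, 0)}" by (auto simp: supp_def e_def split: if_splits)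
  moreover have "(- m, j, 0) \<in> CT_pos (?S c) W"
    using j qW move_back[of c 0 "fst (W ! j)"] by (simp add: pos_iff S_eps_diag)
  ultimately have "finite (supp e)" "supp e \<subseteq> CT_pos (?S c) W"
    by (auto intro: finite_subset)
  then obtain u where u: "u \<in> carrier (Hom cat_CT (?S c) W)" "CT_co (?S c) W u = e"
    by (rule CT.ex_co)
  have coeff: "CT_co (?S d) X (restr p X d c (Cmp cat_CT (?S c) W X f u)) (n - m, i, 0) = CT_co W X f (n, i, j)"
    if f: "f \<in> carrier (Hom cat_CT W X)" and d: "0 < d" "d \<le> c" for f d
  proof -
    have pos: "(n - m, i, 0) \<in> CT_pos (?S d') X" if "0 < d'" "d' \<le> c" for d'
      using germ[OF that] i by (simp add: pos_iff S_eps_diag move_back)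
    have "conv (CT_co W X f) e (n - m, i, 0) = (\<Sum>(k, l) \<in> {(- m, j)}. CT_co W X f (n - m - k, i, l) * e (k, l, 0))"
      using \<open>finite (supp e)\<close> by (intro conv_eq_sum) (auto simp: e_def split: if_splits)
    also have "\<dots> = CT_co W X f (n, i, j)" by (simp add: e_def)
    finally show ?thesis
      using pos[OF d] pos[of c] c d by (simp add: CT_co_restr CT.Cmp_closed u f CT.co_Cmp truncate_def)
  qed
  have "((c, Cmp cat_CT (?S c) W X g u), (c, Cmp cat_CT (?S c) W X h u)) \<notin> germ_rel p X"
  proof
    assume "((c, Cmp cat_CT (?S c) W X g u), (c, Cmp cat_CT (?S c) W X h u)) \<in> germ_rel p X"
    then obtain d where d: "0 < d" "d \<le> c"
      "restr p X d c (Cmp cat_CT (?S c) W X g u) = restr p X d c (Cmp cat_CT (?S c) W X h u)"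
      by (auto simp: germ_rel_iff)
    then show False using coeff[OF g d(1,2)] coeff[OF h d(1,2)] gh by simp
  qed
  then show thesis using that p c(1) u(1) by blast
qed

theorem corollary2p4p6:
  fixes X Y :: "pt2 list" and f :: "'k::field ct_mor"
  assumes "X \<in> Obj (cat_CT :: (pt2 list, 'k ct_mor) precat)"
    and "Y \<in> Obj (cat_CT :: (pt2 list, 'k ct_mor) precat)"
    and "f \<in> carrier (Hom cat_CT X Y)"
  shows "is_mono cat_CT X Y f \<longleftrightarrow>
    (\<forall>p \<in> std_cluster. inj_on (tau_Hom_map p X Y f) (tau_Hom p X))"
proof
  note f = assms(3)
  assume mono: "is_mono cat_CT X Y f"
  show "\<forall>p \<in> std_cluster. inj_on (tau_Hom_map p X Y f) (tau_Hom p X)"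
  proof
    fix p assume p: "p \<in> std_cluster"
    have "((e, g), (d, h)) \<in> germ_rel p X"
      if gh: "(e, g) \<in> germs p X" "(d, h) \<in> germs p X"
        and rel: "((e, Cmp cat_CT (S_eps p e) X Y f g), (d, Cmp cat_CT (S_eps p d) X Y f h)) \<in> germ_rel p Y"
      for e d and g h :: "'k ct_mor"
    proof -
      obtain c where c: "0 < c" "c \<le> e" "c \<le> d"
        and eq: "restr p Y c e (Cmp cat_CT (S_eps p e) X Y f g) = restr p Y c d (Cmp cat_CT (S_eps p d) X Y f h)"
        using rel by (auto simp: germ_rel_iff)
      have g: "g \<in> carrier (Hom cat_CT (S_eps p e) X)" and h: "h \<in> carrier (Hom cat_CT (S_eps p d) X)"
        using gh by (auto simp: germs_iff)
      have "S_eps p c \<in> Obj (cat_CT :: (pt2 list, 'k ct_mor) precat)"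
        using std_cluster_strip[OF p] by (simp add: Obj_CT S_eps_diag diag_def)
      moreover have "Cmp cat_CT (S_eps p c) X Y f (restr p X c e g) = Cmp cat_CT (S_eps p c) X Y f (restr p X c d h)"
        using eq c g h f by (simp add: Cmp_restr)
      ultimately have "restr p X c e g = restr p X c d h"
        using mono restr_closed[OF c(2) g] restr_closed[OF c(3) h] unfolding is_mono_def by blast
      then show ?thesis using gh c by (auto simp: germ_rel_iff)
    qed
    then show "inj_on (tau_Hom_map p X Y f) (tau_Hom p X)"
      unfolding inj_on_tau_Hom_map_iff[OF f] by blast
  qed
next
  note f = assms(3)
  assume inj: "\<forall>p \<in> std_cluster. inj_on (tau_Hom_map p X Y f) (tau_Hom p X)"
  have "g = h" if g: "g \<in> carrier (Hom cat_CT W X)" and h: "h \<in> carrier (Hom cat_CT W X)"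
    and eq: "Cmp cat_CT W X Y f g = Cmp cat_CT W X Y f h" for W and g h :: "'k ct_mor"
  proof (rule ccontr)
    assume "g \<noteq> h"
    then obtain p c u where p: "p \<in> std_cluster" and c: "0 < c" and u: "u \<in> carrier (Hom cat_CT (S_eps p c) W)"
      and sep: "((c, Cmp cat_CT (S_eps p c) W X g u), (c, Cmp cat_CT (S_eps p c) W X h u)) \<notin> germ_rel p X"
      using separating_germ[OF g h] by blast
    let ?gu = "Cmp cat_CT (S_eps p c) W X g u" and ?hu = "Cmp cat_CT (S_eps p c) W X h u"
    have germs: "(c, ?gu) \<in> germs p X" "(c, ?hu) \<in> germs p X"
      using c g h u by (auto simp: germs_iff CT.Cmp_closed)
    have "Cmp cat_CT (S_eps p c) X Y f ?gu = Cmp cat_CT (S_eps p c) X Y f ?hu"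
      using eq CT.Cmp_assoc[OF u g f] CT.Cmp_assoc[OF u h f] by simp
    moreover have "(c, Cmp cat_CT (S_eps p c) X Y f ?gu) \<in> germs p Y"
      using c CT.Cmp_closed[OF CT.Cmp_closed[OF u g] f] by (simp add: germs_iff)
    ultimately have "((c, Cmp cat_CT (S_eps p c) X Y f ?gu), (c, Cmp cat_CT (S_eps p c) X Y f ?hu)) \<in> germ_rel p Y"
      using c by (auto simp: germ_rel_iff)
    then have "((c, ?gu), (c, ?hu)) \<in> germ_rel p X"
      using inj p germs unfolding inj_on_tau_Hom_map_iff[OF f] by blast
    then show False using sep by blast
  qed
  then show "is_mono cat_CT X Y f"
    using f unfolding is_mono_def by blast
qed

end
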